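(* Let $(\mathbb M^n,g)$ be an $n$-dimensional complete Riemannian manifold and let $\Omega\subset\mathbb M^n$ be a nonempty bounded open subdomain. In the infima below $K$ ranges over the compact subsets of $\Omega$ with $|K|>0$. (i) Let $p\in[1,\infty]$ with $p\neq n$. If $p<\infty$ and $\alpha$ is a real number with $\alpha<1-\frac pn$, then $$\inf_{K\subset\subset\Omega}|K|^{-\alpha}\,{\rm cap}_p(K,\Omega)=0 .$$ If $p=\infty$, then $$\inf_{K\subset\subset\Omega}|K|^{\frac1n}\,{\rm cap}_\infty(K,\Omega)=0 .$$ (ii) Let $p=n\ge 2$. Then for every $\beta>n^{\frac n{n-1}}\nu_n^{\frac1{n-1}}$, $$\inf_{K\subset\subset\Omega}|K|^{-1}\exp\left(-\beta\,\big({\rm cap}_n(K,\Omega)\big)^{\frac1{1-n}}\right)=0 .$$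
   Context: $|\cdot|$ denotes Riemannian volume, with volume element $d\upsilon_g$; $\nu_n=|\mathbb B^n|$ is the volume of the unit ball of $\mathbb R^n$. $K\subset\subset\Omega$ means that $K$ is a compact subset of $\Omega$. $C_0^1(\Omega)$ is the space of compactly supported $C^1$ functions on $\Omega$, and $1_K$ is the indicator function of $K$. The relative $p$-capacity is $${\rm cap}_p(K,\Omega)=\inf\Big\{\int_\Omega|\nabla f|^p\,d\upsilon_g:\ 1_K\le f\in C_0^1(\Omega)\Big\}\quad\text{for }p<\infty,$$ $${\rm cap}_\infty(K,\Omega)=\inf\Big\{\sup_{x\in\Omega}|\nabla f(x)|:\ 1_K\le f\in C_0^1(\Omega)\Big\}.$$ Convention: if ${\rm cap}_n(K,\Omega)=0$, then $\big({\rm cap}_n(K,\Omega)\big)^{1/(1-n)}=+\infty$ and $\exp(-\infty)=0$. *)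

theory Defs
  imports "HOL-Analysis.Analysis"
begin

text \<open>
  A manifold is a whole type \<open>'a\<close>, Hausdorff and second countable, together with a smooth atlas
  modelled on \<open>real ^ 'n\<close>; its dimension is \<open>CARD('n)\<close>. It is not assumed to be connected.
\<close>

primrec Ck_on :: "nat \<Rightarrow> (real ^ 'n) set \<Rightarrow> (real ^ 'n \<Rightarrow> 'b::real_normed_vector) \<Rightarrow> bool" where
  "Ck_on 0 S f \<longleftrightarrow> continuous_on S f"
| "Ck_on (Suc k) S f \<longleftrightarrow>
     (\<forall>x\<in>S. f differentiable (at x)) \<and>
     (\<forall>i. Ck_on k S (\<lambda>x. frechet_derivative f (at x) (axis i 1)))"

definition smooth_on :: "(real ^ 'n) set \<Rightarrow> (real ^ 'n \<Rightarrow> 'b::real_normed_vector) \<Rightarrow> bool" where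
  "smooth_on S f \<longleftrightarrow> (\<forall>k. Ck_on k S f)"

type_synonym ('a, 'n) chart = "'a set \<times> ('a \<Rightarrow> real ^ 'n)"

abbreviation chart_inv :: "('a, 'n::finite) chart \<Rightarrow> real ^ 'n \<Rightarrow> 'a" where
  "chart_inv c \<equiv> inv_into (fst c) (snd c)"

definition is_chart :: "('a::topological_space, 'n::finite) chart \<Rightarrow> bool" where
  "is_chart c \<longleftrightarrow> open (fst c) \<and> open (snd c ` fst c) \<and>
     homeomorphism (fst c) (snd c ` fst c) (snd c) (chart_inv c)"

definition smooth_atlas :: "('a::topological_space, 'n::finite) chart set \<Rightarrow> bool" where
  "smooth_atlas A \<longleftrightarrow>
     (\<forall>c\<in>A. is_chart c) \<and> (\<Union>c\<in>A. fst c) = UNIV \<and>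
     (\<forall>c\<in>A. \<forall>d\<in>A. smooth_on (snd c ` (fst c \<inter> fst d)) (snd d \<circ> chart_inv c))"

text \<open>
  A metric assigns to each chart \<open>c\<close> and each point \<open>x\<close> of its domain the Gram matrix \<open>g c x\<close> of
  the coordinate frame of \<open>c\<close> at \<open>x\<close>. Values of \<open>g c x\<close> for \<open>x\<close> outside the domain are irrelevant.
\<close>

type_synonym ('a, 'n) metric_coeffs = "('a, 'n) chart \<Rightarrow> 'a \<Rightarrow> real ^ 'n ^ 'n"

definition transition_jacobian ::
  "('a, 'n::finite) chart \<Rightarrow> ('a, 'n) chart \<Rightarrow> 'a \<Rightarrow> real ^ 'n ^ 'n" where
  "transition_jacobian c d x =
     matrix (frechet_derivative (snd d \<circ> chart_inv c) (at (snd c x)))"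

definition riemannian_metric ::
  "('a, 'n::finite) chart set \<Rightarrow> ('a, 'n) metric_coeffs \<Rightarrow> bool" where
  "riemannian_metric A g \<longleftrightarrow>
     (\<forall>c\<in>A. \<forall>x\<in>fst c. transpose (g c x) = g c x \<and>
        (\<forall>v. v \<noteq> 0 \<longrightarrow> 0 < v \<bullet> (g c x *v v))) \<and>
     (\<forall>c\<in>A. smooth_on (snd c ` fst c) (\<lambda>y. g c (chart_inv c y))) \<and>
     (\<forall>c\<in>A. \<forall>d\<in>A. \<forall>x\<in>fst c \<inter> fst d.
        g c x = transpose (transition_jacobian c d x) ** g d x ** transition_jacobian c d x)"

definition riemannian_manifold ::
  "('a::{second_countable_topology, t2_space}, 'n::finite) chart set
     \<Rightarrow> ('a, 'n) metric_coeffs \<Rightarrow> bool" where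
  "riemannian_manifold A g \<longleftrightarrow> smooth_atlas A \<and> riemannian_metric A g"

text \<open>
  Pointwise norms are computed in an arbitrary chart around the point; by the transformation law
  of \<^const>\<open>riemannian_metric\<close> they do not depend on which one is chosen.
\<close>

definition chart_at :: "('a, 'n::finite) chart set \<Rightarrow> 'a \<Rightarrow> ('a, 'n) chart" where
  "chart_at A x = (SOME c. c \<in> A \<and> x \<in> fst c)"

definition metric_norm ::
  "('a, 'n::finite) metric_coeffs \<Rightarrow> ('a, 'n) chart \<Rightarrow> 'a \<Rightarrow> real ^ 'n \<Rightarrow> real" where
  "metric_norm g c x v = sqrt (v \<bullet> (g c x *v v))"

definition C1_curve_on ::
  "('a::topological_space, 'n::finite) chart set \<Rightarrow> (real \<Rightarrow> 'a) \<Rightarrow> real \<Rightarrow> real \<Rightarrow> bool" where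
  "C1_curve_on A \<gamma> a b \<longleftrightarrow> continuous_on {a..b} \<gamma> \<and>
     (\<forall>c\<in>A. \<exists>D. continuous_on {t\<in>{a..b}. \<gamma> t \<in> fst c} D \<and>
        (\<forall>t\<in>{a..b}. \<gamma> t \<in> fst c \<longrightarrow>
           ((snd c \<circ> \<gamma>) has_vector_derivative D t) (at t within {a..b})))"

definition piecewise_C1_curve ::
  "('a::topological_space, 'n::finite) chart set \<Rightarrow> (real \<Rightarrow> 'a) \<Rightarrow> bool" where
  "piecewise_C1_curve A \<gamma> \<longleftrightarrow>
     (\<exists>S. finite S \<and> {0, 1} \<subseteq> S \<and> S \<subseteq> {0..1} \<and>
        (\<forall>a\<in>S. \<forall>b\<in>S. a < b \<and> {a<..<b} \<inter> S = {} \<longrightarrow> C1_curve_on A \<gamma> a b))"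

definition curve_length ::
  "('a, 'n::finite) chart set \<Rightarrow> ('a, 'n) metric_coeffs \<Rightarrow> (real \<Rightarrow> 'a) \<Rightarrow> ennreal" where
  "curve_length A g \<gamma> =
     (\<integral>\<^sup>+t\<in>{0..1}. ennreal (let c = chart_at A (\<gamma> t) in
        metric_norm g c (\<gamma> t) (vector_derivative (snd c \<circ> \<gamma>) (at t))) \<partial>lborel)"

text \<open>The distance between points of different connected components is \<open>\<infinity>\<close>.\<close>

definition riem_dist ::
  "('a::topological_space, 'n::finite) chart set \<Rightarrow> ('a, 'n) metric_coeffs \<Rightarrow> 'a \<Rightarrow> 'a \<Rightarrow> ennreal"
  where
  "riem_dist A g x y =
     (INF \<gamma>\<in>{\<gamma>. piecewise_C1_curve A \<gamma> \<and> \<gamma> 0 = x \<and> \<gamma> 1 = y}. curve_length A g \<gamma>)"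

definition riem_complete ::
  "('a::topological_space, 'n::finite) chart set \<Rightarrow> ('a, 'n) metric_coeffs \<Rightarrow> bool" where
  "riem_complete A g \<longleftrightarrow>
     (\<forall>X::nat \<Rightarrow> 'a. (\<forall>e>0. \<exists>N. \<forall>m\<ge>N. \<forall>k\<ge>N. riem_dist A g (X m) (X k) < e) \<longrightarrow>
        (\<exists>x. (\<lambda>k. riem_dist A g (X k) x) \<longlonglongrightarrow> 0))"

definition riem_bounded ::
  "('a::topological_space, 'n::finite) chart set \<Rightarrow> ('a, 'n) metric_coeffs \<Rightarrow> 'a set \<Rightarrow> bool" where
  "riem_bounded A g S \<longleftrightarrow> (\<exists>R::real. \<forall>x\<in>S. \<forall>y\<in>S. riem_dist A g x y \<le> ennreal R)"

text \<open>
  The Riemannian volume is the only Borel measure with density \<open>sqrt (det g)\<close> in every chart.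
  It is unique because countably many chart domains cover the manifold, and it exists by the
  change of variables formula.
\<close>

definition riem_volume ::
  "('a::topological_space, 'n::finite) chart set \<Rightarrow> ('a, 'n) metric_coeffs \<Rightarrow> 'a measure" where
  "riem_volume A g =
     (THE \<mu>. sets \<mu> = sets borel \<and>
        (\<forall>c\<in>A. \<forall>B\<in>sets borel. B \<subseteq> fst c \<longrightarrow>
           emeasure \<mu> B =
             (\<integral>\<^sup>+y\<in>snd c ` B. ennreal (sqrt (det (g c (chart_inv c y)))) \<partial>lborel)))"

definition coord_gradient ::
  "('a, 'n::finite) metric_coeffs \<Rightarrow> ('a, 'n) chart \<Rightarrow> ('a \<Rightarrow> real) \<Rightarrow> 'a \<Rightarrow> real ^ 'n" where
  "coord_gradient g c f x =
     matrix_inv (g c x) *v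
       (\<chi> i. frechet_derivative (f \<circ> chart_inv c) (at (snd c x)) (axis i 1))"

definition gradient_norm ::
  "('a, 'n::finite) chart set \<Rightarrow> ('a, 'n) metric_coeffs \<Rightarrow> ('a \<Rightarrow> real) \<Rightarrow> 'a \<Rightarrow> real" where
  "gradient_norm A g f x =
     (let c = chart_at A x in metric_norm g c x (coord_gradient g c f x))"

text \<open>
  Elements of \<open>C01 A \<Omega>\<close> are meant as functions on the open set \<open>\<Omega>\<close>; their values elsewhere are
  unconstrained and never used.
\<close>

definition C01 ::
  "('a::topological_space, 'n::finite) chart set \<Rightarrow> 'a set \<Rightarrow> ('a \<Rightarrow> real) set" where
  "C01 A \<Omega> = {f. (\<forall>c\<in>A. Ck_on 1 (snd c ` (fst c \<inter> \<Omega>)) (f \<circ> chart_inv c)) \<and>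
                 (\<exists>C. compact C \<and> C \<subseteq> \<Omega> \<and> (\<forall>x\<in>\<Omega> - C. f x = 0))}"

definition p_capacity ::
  "('a::topological_space, 'n::finite) chart set \<Rightarrow> ('a, 'n) metric_coeffs
     \<Rightarrow> real \<Rightarrow> 'a set \<Rightarrow> 'a set \<Rightarrow> ennreal" where
  "p_capacity A g p K \<Omega> =
     (INF f\<in>{f \<in> C01 A \<Omega>. \<forall>x\<in>\<Omega>. indicator K x \<le> f x}.
        \<integral>\<^sup>+x\<in>\<Omega>. ennreal (gradient_norm A g f x powr p) \<partial>riem_volume A g)"

definition infty_capacity ::
  "('a::topological_space, 'n::finite) chart set \<Rightarrow> ('a, 'n) metric_coeffs
     \<Rightarrow> 'a set \<Rightarrow> 'a set \<Rightarrow> ennreal" where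
  "infty_capacity A g K \<Omega> =
     (INF f\<in>{f \<in> C01 A \<Omega>. \<forall>x\<in>\<Omega>. indicator K x \<le> f x}.
        SUP x\<in>\<Omega>. ennreal (gradient_norm A g f x))"

text \<open>
  \<open>exp (-\<beta> C\<^bsup>1/(1-n)\<^esup>)\<close> for a capacity \<open>C\<close>, read as \<open>exp (-\<infinity>) = 0\<close> when \<open>C = 0\<close>.
  At \<open>C = \<infinity>\<close> the formula yields \<open>1\<close>, the correct limit.
\<close>

definition exp_neg_capacity :: "real \<Rightarrow> real \<Rightarrow> ennreal \<Rightarrow> real" where
  "exp_neg_capacity \<beta> n C =
     (if C = 0 then 0 else exp (- \<beta> * enn2real C powr (1 / (1 - n))))"

definition pos_compacts ::
  "('a::topological_space, 'n::finite) chart set \<Rightarrow> ('a, 'n) metric_coeffs \<Rightarrow> 'a set \<Rightarrow> 'a set set"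
  where
  "pos_compacts A g \<Omega> = {K. compact K \<and> K \<subseteq> \<Omega> \<and> 0 < emeasure (riem_volume A g) K}"

end

theory Submission
  imports Defs "HOL-Real_Asymp.Real_Asymp"
begin

text \<open>
  The statements are local, so one small ball inside \<open>\<Omega>\<close> decides them. Fix a
  point of \<open>\<Omega>\<close>, a chart around it, and factor the Gram matrix there as \<open>M\<^sup>T M\<close>. By continuity of the
  metric, the radius function \<open>\<rho> = \<bar>M (c x - c x\<^sub>0)\<bar>\<close> has, on a small ball \<open>\<rho> \<le> R\<close>, the volumes of
  Euclidean shells up to a factor \<open>1 \<plusminus> \<epsilon>\<close>, and a function of \<open>\<rho>\<close> has its Euclidean gradient up to a
  factor \<open>1 + \<epsilon>\<close>. The locale \<open>almost_euclidean_ball\<close> records this, and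
  \<open>almost_euclidean_ball_exists\<close> provides such a ball for each \<open>\<epsilon>\<close>.

  The test functions are averages of \<open>N\<close> cutoffs, each of which drops from \<open>1\<close> to \<open>0\<close> across one of
  the shells \<open>b\<^bsup>k+1\<^esup> r \<le> \<rho> \<le> b\<^bsup>k\<^esup> r\<close> with \<open>k < N\<close>. The shells do not overlap, so at every point at most
  one of the cutoffs has a gradient, and the \<open>p\<close>-energies of the cutoffs add up
  (\<open>layered_test_function\<close>, \<open>p_capacity_le\<close>). A single cutoff shows that the \<open>p\<close>-capacity of the ball
  of radius \<open>r / 2\<close> is \<open>O(r\<^bsup>n - p\<^esup>)\<close>, while its volume is comparable to \<open>r\<^sup>n\<close>; the product for
  \<open>p < \<infinity>\<close> in the first part is \<open>O(r\<^bsup>n - p - n \<alpha>\<^esup>)\<close>, with a positive exponent. For \<open>p = \<infinity>\<close> one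
  cutoff of fixed width serves all smaller balls, whose volumes tend to \<open>0\<close>.

  In the critical case \<open>p = n\<close> the energy of one cutoff is scale invariant, so \<open>N\<close> layers give the
  ball of radius \<open>b\<^sup>N R\<close> a capacity of at most \<open>E N\<^bsup>1 - n\<^esup>\<close>, where \<open>E\<close> does not depend on \<open>N\<close>.
  The quantity in the second part is then at most a constant times
  \<open>exp (N (n ln (1 / b) - \<beta> E\<^bsup>1 / (1 - n)\<^esup>))\<close>, which tends to \<open>0\<close> as soon as
  \<open>n ln (1 / b) E\<^bsup>1 / (n - 1)\<^esup> < \<beta>\<close>. As \<open>b\<close> tends to \<open>1\<close> and \<open>\<epsilon>\<close> to \<open>0\<close>, the layers approximate the
  logarithmic extremal function of an annulus and the left-hand side tends to the critical
  constant (\<open>sharp_constant_limit\<close>).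

  The volume is characterised only by its values on chart domains, so its existence and uniqueness
  have to be established first. This rests on the change of variables formula.
\<close>

section \<open>Change of variables for nonnegative integrals\<close>

text \<open>
  The theorem \<open>has_absolute_integral_change_of_variables\<close> speaks about well-ordered index types. A
  copy of a finite index type, ordered through its embedding into the natural numbers, transfers
  it to spaces \<open>real ^ 'n\<close> over an arbitrary finite index type.
\<close>

typedef 'n wo_copy = "UNIV :: 'n set" morphisms orig copy
  by simp

instance wo_copy :: (finite) finite
proof
  have "(UNIV :: 'a wo_copy set) = copy ` UNIV"
    by (metis orig_inverse surjI)
  then show "finite (UNIV :: 'a wo_copy set)"
    by (metis finite_imageI finite)
qed

instantiation wo_copy :: (finite) wellorder
begin

definition less_eq_wo_copy :: "'a wo_copy \<Rightarrow> 'a wo_copy \<Rightarrow> bool" where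
  "less_eq_wo_copy i j \<longleftrightarrow> to_nat (orig i) \<le> to_nat (orig j)"

definition less_wo_copy :: "'a wo_copy \<Rightarrow> 'a wo_copy \<Rightarrow> bool" where
  "less_wo_copy i j \<longleftrightarrow> to_nat (orig i) < to_nat (orig j)"

instance
proof
  fix P :: "'a wo_copy \<Rightarrow> bool" and a :: "'a wo_copy"
  assume step: "\<And>x. (\<And>y. y < x \<Longrightarrow> P y) \<Longrightarrow> P x"
  show "P a"
    by (induction a rule: measure_induct_rule[where f = "\<lambda>i. to_nat (orig i)"])
       (use step in \<open>auto simp: less_wo_copy_def\<close>)
qed (auto simp: less_eq_wo_copy_def less_wo_copy_def orig_inject)

end

lemma bij_orig: "bij orig" and bij_copy: "bij copy"
  by (metis bijI' copy_inverse orig_inject orig_inverse UNIV_I)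
     (metis bijI' copy_inverse orig_inverse UNIV_I)

definition to_copy :: "real ^ 'n \<Rightarrow> real ^ 'n wo_copy" where
  "to_copy x = (\<chi> i. x $ orig i)"

definition of_copy :: "real ^ 'n wo_copy \<Rightarrow> real ^ 'n" where
  "of_copy y = (\<chi> i. y $ copy i)"

lemma of_to_copy [simp]: "of_copy (to_copy x) = x"
  by (simp add: of_copy_def to_copy_def copy_inverse vec_eq_iff)

lemma to_of_copy [simp]: "to_copy (of_copy y) = y"
  by (simp add: of_copy_def to_copy_def orig_inverse vec_eq_iff)

lemma linear_to_copy: "linear (to_copy :: real ^ 'n::finite \<Rightarrow> _)"
  by (rule linearI) (auto simp: to_copy_def vec_eq_iff)

lemma linear_of_copy: "linear (of_copy :: _ \<Rightarrow> real ^ 'n::finite)"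
  by (rule linearI) (auto simp: of_copy_def vec_eq_iff)

lemmas bounded_linear_copy =
  linear_to_copy[THEN linear_linear[THEN iffD2]] linear_of_copy[THEN linear_linear[THEN iffD2]]

lemma measurable_copy [measurable]:
  "(to_copy :: real ^ 'n::finite \<Rightarrow> _) \<in> borel_measurable borel"
  "(of_copy :: _ \<Rightarrow> real ^ 'n::finite) \<in> borel_measurable borel"
  by (intro borel_measurable_continuous_onI linear_continuous_on bounded_linear_copy)+

lemma image_to_copy: "to_copy ` S = of_copy -` S"
  by (auto simp: image_iff) (metis to_of_copy)

text \<open>
  Renaming coordinates permutes the side lengths of a box, and boxes determine Lebesgue measure.
\<close>

lemma lborel_copy: "lborel = distr lborel borel (to_copy :: real ^ 'n::finite \<Rightarrow> _)"
proof (rule lborel_eqI)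
  fix l u :: "real ^ 'n wo_copy"
  assume lu: "\<And>b. b \<in> Basis \<Longrightarrow> l \<bullet> b \<le> u \<bullet> b"
  then have le: "l $ i \<le> u $ i" for i
    using lu[of "axis i 1"] by (simp add: inner_axis)
  have basis: "(\<Prod>b\<in>Basis. w \<bullet> b) = (\<Prod>i\<in>UNIV. w $ i)" for w :: "real ^ 'm::finite"
    unfolding Basis_vec_def
    by (subst prod.UNION_disjoint) (auto simp: axis_eq_axis inner_axis)
  have "to_copy -` box l u = box (of_copy l) (of_copy u)"
    unfolding of_copy_def to_copy_def
    by (auto simp: mem_box_cart)
       (metis orig_inverse copy_inverse UNIV_I)+
  then have "emeasure (distr lborel borel to_copy) (box l u)
      = emeasure lborel (box (of_copy l) (of_copy u))"
    by (subst emeasure_distr) auto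
  also have "\<dots> = ennreal (\<Prod>b\<in>Basis. (of_copy u - of_copy l) \<bullet> b)"
    using le by (subst emeasure_lborel_box) (auto simp: Basis_vec_def inner_axis of_copy_def)
  also have "(\<Prod>b\<in>Basis. (of_copy u - of_copy l) \<bullet> b) = (\<Prod>i\<in>UNIV. (u - l) $ copy i)"
    by (simp add: basis of_copy_def)
  also have "\<dots> = (\<Prod>i\<in>UNIV. (u - l) $ i)"
    using bij_copy by (rule prod.reindex_bij_betw)
  finally show "emeasure (distr lborel borel to_copy) (box l u) = (\<Prod>b\<in>Basis. (u - l) \<bullet> b)"
    by (simp add: basis)
qed simp

text \<open>
  Renaming the indices conjugates every permutation in the Leibniz formula, which preserves signs.
\<close>

lemma det_copy:
  fixes B :: "real ^ 'n::finite ^ 'n"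
  shows "det (\<chi> i j. B $ orig i $ orig j) = det B"
proof -
  let ?m = "map_permutation UNIV (copy :: 'n \<Rightarrow> _)"
  have inj: "inj (copy :: 'n \<Rightarrow> _)"
    using bij_copy bij_is_inj by blast
  have bij: "bij (copy :: 'n \<Rightarrow> _)" "bij (orig :: _ \<Rightarrow> 'n)" "inj (orig :: _ \<Rightarrow> 'n)"
    using bij_copy bij_orig bij_is_inj by blast+
  have m: "?m p i = copy (p (orig i))" for p i
    using bij_copy inj
    by (auto simp: map_permutation_def restrict_id_def bij_betw_def)
       (metis inv_f_f orig_inverse)
  have "det (\<chi> i j. B $ orig i $ orig j)
      = (\<Sum>q | q permutes UNIV. of_int (sign q) * (\<Prod>i\<in>UNIV. B $ orig i $ orig (q i)))"
    by (simp add: det_def)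
  also have "\<dots> = (\<Sum>p | p permutes UNIV. of_int (sign (?m p)) * (\<Prod>i\<in>UNIV. B $ orig i $ orig (?m p i)))"
  proof (rule sum.reindex_bij_betw[symmetric], rule bij_betw_byWitness)
    show "\<forall>p\<in>{p. p permutes UNIV}. map_permutation UNIV orig (?m p) = p"
      using bij inj
      by (auto simp: map_permutation_compose comp_def copy_inverse map_permutation_ident)
    show "\<forall>q\<in>{q. q permutes UNIV}. ?m (map_permutation UNIV orig q) = q"
      using bij inj
      by (auto simp: map_permutation_compose comp_def orig_inverse map_permutation_ident)
  qed (use bij_copy bij_orig in \<open>auto intro!: map_permutation_permutes\<close>)
  also have "\<dots> = det B"
    unfolding det_def
  proof (intro sum.cong refl)
    fix p :: "'n \<Rightarrow> 'n" assume "p \<in> {p. p permutes UNIV}"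
    then have "sign (?m p) = sign p"
      using inj by (intro sign_map_permutation) auto
    moreover have "(\<Prod>i\<in>UNIV. B $ orig i $ orig (?m p i)) = (\<Prod>i\<in>UNIV. B $ i $ p i)"
      unfolding m using prod.reindex_bij_betw[OF bij_orig, of "\<lambda>i. B $ i $ p i"]
      by (simp add: copy_inverse)
    ultimately show "of_int (sign (?m p)) * (\<Prod>i\<in>UNIV. B $ orig i $ orig (?m p i))
        = of_int (sign p) * (\<Prod>i\<in>UNIV. B $ i $ p i)"
      by simp
  qed
  finally show ?thesis .
qed

text \<open>
  This dictionary between the two integrals lets an equivalence about finite integrals imply an
  equality of possibly infinite ones: if one side is infinite, no finite value is attained by either.
\<close>

lemma absolutely_integrable_iff_nn_integral:
  fixes h :: "'a::euclidean_space \<Rightarrow> real"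
  assumes "X \<in> sets borel" "\<And>x. x \<in> X \<Longrightarrow> 0 \<le> h x" "0 \<le> b"
    and "(\<lambda>x. indicator X x * h x) \<in> borel_measurable borel"
  shows "(h absolutely_integrable_on X \<and> integral X h = b) \<longleftrightarrow>
      (\<integral>\<^sup>+x\<in>X. ennreal (h x) \<partial>lborel) = ennreal b"
proof
  assume h: "h absolutely_integrable_on X \<and> integral X h = b"
  then have "(h has_integral b) X"
    using absolutely_integrable_on_def by blast
  then show "(\<integral>\<^sup>+x\<in>X. ennreal (h x) \<partial>lborel) = ennreal b"
    using assms by (intro nn_integral_has_integral_lebesgue') auto
next
  assume h: "(\<integral>\<^sup>+x\<in>X. ennreal (h x) \<partial>lborel) = ennreal b"
  have "(\<integral>\<^sup>+x. ennreal (indicator X x * h x) \<partial>lborel) = ennreal b"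
    by (subst h[symmetric], rule nn_integral_cong) (auto simp: indicator_def)
  then have "((\<lambda>x. indicator X x * h x) has_integral b) UNIV"
    using assms by (intro nn_integral_has_integral) (auto simp: indicator_def)
  also have "(\<lambda>x. indicator X x * h x) = (\<lambda>x. if x \<in> X then h x else 0)"
    by (auto simp: indicator_def)
  finally have "(h has_integral b) X"
    by (simp add: has_integral_restrict_UNIV)
  then show "h absolutely_integrable_on X \<and> integral X h = b"
    using assms by (auto simp: has_integral_iff intro!: nonnegative_absolutely_integrable_1)
qed

lemma nn_integral_change_of_variables_wellorder:
  fixes f :: "real ^ 'm::{finite,wellorder} \<Rightarrow> real"
  assumes S: "S \<in> sets borel" and TS: "T ` S \<in> sets borel"
    and der: "\<And>x. x \<in> S \<Longrightarrow> (T has_derivative T' x) (at x within S)"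
    and inj: "inj_on T S"
    and f0: "\<And>x. x \<in> T ` S \<Longrightarrow> 0 \<le> f x"
    and f: "(\<lambda>x. indicator (T ` S) x * f x) \<in> borel_measurable borel"
    and Tf: "(\<lambda>x. indicator S x * (\<bar>det (matrix (T' x))\<bar> * f (T x))) \<in> borel_measurable borel"
  shows "(\<integral>\<^sup>+y\<in>T ` S. ennreal (f y) \<partial>lborel)
       = (\<integral>\<^sup>+x\<in>S. ennreal (\<bar>det (matrix (T' x))\<bar> * f (T x)) \<partial>lborel)"
proof -
  have eq: "(\<integral>\<^sup>+y\<in>T ` S. ennreal (f y) \<partial>lborel) = ennreal b \<longleftrightarrow>
        (\<integral>\<^sup>+x\<in>S. ennreal (\<bar>det (matrix (T' x))\<bar> * f (T x)) \<partial>lborel) = ennreal b"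
    if "0 \<le> b" for b
  proof -
    have "(f absolutely_integrable_on (T ` S) \<and> integral (T ` S) f = b) \<longleftrightarrow>
        (\<lambda>x. \<bar>det (matrix (T' x))\<bar> * f (T x)) absolutely_integrable_on S \<and>
        integral S (\<lambda>x. \<bar>det (matrix (T' x))\<bar> * f (T x)) = b"
      using has_absolute_integral_change_of_variables
          [OF _ der inj, where f = "\<lambda>y. vec (f y) :: real ^ 1" and b = "vec b"] S
      unfolding absolutely_integrable_on_1_iff integral_on_1_eq
      by (simp add: vec_eq_iff)
    moreover have "0 \<le> \<bar>det (matrix (T' x))\<bar> * f (T x)" if "x \<in> S" for x
      using f0 that by simp
    ultimately show ?thesis
      using absolutely_integrable_iff_nn_integral[OF TS f0 that f]
        absolutely_integrable_iff_nn_integral[OF S _ that Tf] by simp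
  qed
  show ?thesis
  proof (cases "\<integral>\<^sup>+y\<in>T ` S. ennreal (f y) \<partial>lborel" rule: ennreal_cases)
    case (real r)
    then show ?thesis using eq[of r] by simp
  next
    case top
    then show ?thesis
      using eq by (cases "\<integral>\<^sup>+x\<in>S. ennreal (\<bar>det (matrix (T' x))\<bar> * f (T x)) \<partial>lborel" rule: ennreal_cases) auto
  qed
qed

text \<open>
  The map is conjugated with the renaming of coordinates, which preserves both the measure and the
  determinant of the derivative.
\<close>

lemma nn_integral_change_of_variables:
  fixes f :: "real ^ 'n::finite \<Rightarrow> real"
  assumes S: "S \<in> sets borel" and TS: "T ` S \<in> sets borel"
    and der: "\<And>x. x \<in> S \<Longrightarrow> (T has_derivative T' x) (at x within S)"
    and inj: "inj_on T S"
    and f0: "\<And>x. x \<in> T ` S \<Longrightarrow> 0 \<le> f x"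
    and f: "(\<lambda>x. indicator (T ` S) x * f x) \<in> borel_measurable borel"
    and Tf: "(\<lambda>x. indicator S x * (\<bar>det (matrix (T' x))\<bar> * f (T x))) \<in> borel_measurable borel"
  shows "(\<integral>\<^sup>+y\<in>T ` S. ennreal (f y) \<partial>lborel)
       = (\<integral>\<^sup>+x\<in>S. ennreal (\<bar>det (matrix (T' x))\<bar> * f (T x)) \<partial>lborel)"
proof -
  define U where "U = to_copy \<circ> T \<circ> of_copy"
  define U' where "U' y = to_copy \<circ> T' (of_copy y) \<circ> of_copy" for y
  have image: "U ` to_copy ` S = to_copy ` T ` S"
    by (auto simp: U_def image_image)
  have det: "det (matrix (U' y)) = det (matrix (T' (of_copy y)))" for y
  proof -
    have "of_copy (axis i 1) = axis (orig i) (1::real)" for i :: "'n wo_copy"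
      by (auto simp: of_copy_def axis_def vec_eq_iff) (metis orig_inverse copy_inverse UNIV_I)+
    then have "matrix (U' y) = (\<chi> i j. matrix (T' (of_copy y)) $ orig i $ orig j)"
      by (simp add: U'_def matrix_def to_copy_def)
    then show ?thesis
      by (simp add: det_copy)
  qed
  have sets: "to_copy ` X \<in> sets borel" if "X \<in> sets borel" for X :: "(real ^ 'n) set"
    unfolding image_to_copy using measurable_sets_borel[OF measurable_copy(2) that] by simp
  have der': "(U has_derivative U' y) (at y within to_copy ` S)" if "y \<in> to_copy ` S" for y
  proof -
    have "of_copy ` to_copy ` S = S"
      by (auto simp: image_image)
    moreover have "of_copy y \<in> S"
      using that by auto
    ultimately have "(T has_derivative T' (of_copy y)) (at (of_copy y) within of_copy ` to_copy ` S)"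
      using der by simp
    then have "(T \<circ> of_copy has_derivative T' (of_copy y) \<circ> of_copy) (at y within to_copy ` S)"
      by (intro diff_chain_within bounded_linear_imp_has_derivative bounded_linear_copy)
    then show ?thesis
      unfolding U_def U'_def comp_assoc
      by (intro diff_chain_within[OF _ bounded_linear_imp_has_derivative] bounded_linear_copy)
  qed
  have pull: "(\<integral>\<^sup>+y\<in>to_copy ` X. ennreal (h (of_copy y)) \<partial>lborel)
      = (\<integral>\<^sup>+x\<in>X. ennreal (h x) \<partial>lborel)"
    if X: "X \<in> sets borel" and h: "(\<lambda>x. indicator X x * h x) \<in> borel_measurable borel"
    for X and h :: "real ^ 'n \<Rightarrow> real"
  proof -
    have ind: "indicator (to_copy ` X) y = indicator X (of_copy y)" for y
      by (simp add: image_to_copy indicator_def)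
    have "(\<integral>\<^sup>+y\<in>to_copy ` X. ennreal (h (of_copy y)) \<partial>lborel)
        = (\<integral>\<^sup>+y. ennreal (indicator X (of_copy y) * h (of_copy y)) \<partial>lborel)"
      unfolding ind by (rule nn_integral_cong) (auto simp: indicator_def)
    also have "\<dots> = (\<integral>\<^sup>+x. ennreal (indicator X x * h x) \<partial>lborel)"
      unfolding lborel_copy
      using measurable_compose[OF measurable_copy(2) h]
      by (subst nn_integral_distr) auto
    also have "\<dots> = (\<integral>\<^sup>+x\<in>X. ennreal (h x) \<partial>lborel)"
      by (rule nn_integral_cong) (auto simp: indicator_def)
    finally show ?thesis .
  qed
  have meas: "(\<lambda>y. indicator (to_copy ` X) y * h (of_copy y)) \<in> borel_measurable borel"
    if "(\<lambda>x. indicator X x * h x) \<in> borel_measurable borel" for X and h :: "real ^ 'n \<Rightarrow> real"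
    using measurable_compose[OF measurable_copy(2) that]
    by (simp add: image_to_copy indicator_def)
  have "(\<integral>\<^sup>+y\<in>U ` to_copy ` S. ennreal (f (of_copy y)) \<partial>lborel)
      = (\<integral>\<^sup>+x\<in>to_copy ` S. ennreal (\<bar>det (matrix (U' x))\<bar> * f (of_copy (U x))) \<partial>lborel)"
  proof (rule nn_integral_change_of_variables_wellorder)
    show "to_copy ` S \<in> sets borel" "U ` to_copy ` S \<in> sets borel"
      using sets S TS by (auto simp: image)
    show "(\<lambda>x. indicator (U ` to_copy ` S) x * f (of_copy x)) \<in> borel_measurable borel"
      unfolding image using meas[OF f] .
    show "(\<lambda>x. indicator (to_copy ` S) x * (\<bar>det (matrix (U' x))\<bar> * f (of_copy (U x))))
        \<in> borel_measurable borel"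
      using meas[OF Tf] by (simp add: det U_def)
    show "inj_on U (to_copy ` S)"
      using inj by (auto simp: U_def inj_on_def) (metis of_to_copy)
  qed (use der' f0 in \<open>auto simp: image\<close>)
  then show ?thesis
    unfolding image det using pull[OF TS f] pull[OF S Tf] by (simp add: U_def)
qed

section \<open>Positive definite matrices\<close>

lemma symmetric_inner: "transpose G = G \<Longrightarrow> x \<bullet> (G *v y) = y \<bullet> (G *v x)" for G :: "real ^ 'n ^ 'n"
  by (metis dot_lmul_matrix inner_commute vector_transpose_matrix)

text \<open>
  Gram-Schmidt for the inner product \<open>x \<bullet> G y\<close>. A family with fewer members than the dimension can be
  extended, because its image under \<open>G\<close> has a nonzero Euclidean orthogonal vector.
\<close>

lemma positive_definite_orthonormal_family:
  fixes G :: "real ^ 'n::finite ^ 'n"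
  assumes sym: "transpose G = G" and pos: "\<And>v. v \<noteq> 0 \<Longrightarrow> 0 < v \<bullet> (G *v v)"
  shows "\<exists>v :: 'n \<Rightarrow> real ^ 'n. \<forall>i\<in>I. \<forall>j\<in>I. v i \<bullet> (G *v v j) = (if i = j then 1 else 0)"
proof (induction I rule: finite_induct[OF finite])
  case 1
  then show ?case by simp
next
  case (2 k I)
  then obtain v :: "'n \<Rightarrow> real ^ 'n"
    where v: "\<forall>i\<in>I. \<forall>j\<in>I. v i \<bullet> (G *v v j) = (if i = j then 1 else 0)"
    by blast
  let ?S = "(\<lambda>i. G *v v i) ` I"
  have "dim ?S \<le> card I"
    by (meson "2.hyps"(1) card_image_le dim_le_card' finite_imageI order_trans)
  also have "\<dots> < CARD('n)"
    using 2 by (metis UNIV_I finite psubset_card_mono psubsetI subset_UNIV)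
  finally have "dim ?S < DIM(real ^ 'n)"
    by simp
  then obtain w where w: "w \<noteq> 0" "\<And>y. y \<in> span ?S \<Longrightarrow> orthogonal w y"
    using orthogonal_to_subspace_exists by blast
  have w0: "w \<bullet> (G *v v i) = 0" "v i \<bullet> (G *v w) = 0" if "i \<in> I" for i
  proof -
    show "w \<bullet> (G *v v i) = 0"
      using w(2)[OF span_base, of "G *v v i"] that by (auto simp: orthogonal_def)
    then show "v i \<bullet> (G *v w) = 0"
      using symmetric_inner[OF sym] by metis
  qed
  define q where "q = w \<bullet> (G *v w)"
  have q: "q > 0"
    using pos w(1) by (simp add: q_def)
  let ?v = "v(k := w /\<^sub>R sqrt q)"
  have "?v i \<bullet> (G *v ?v j) = (if i = j then 1 else 0)" if "i \<in> insert k I" "j \<in> insert k I" for i j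
  proof (cases "i = k \<and> j = k")
    case True
    have "sqrt q * sqrt q = q"
      using q by simp
    then show ?thesis
      using True q by (simp add: matrix_vector_mult_scaleR q_def[symmetric] field_simps)
  next
    case False
    then show ?thesis
      using that v w0 2 by (auto simp: matrix_vector_mult_scaleR)
  qed
  then show ?case
    by blast
qed

text \<open>
  A \<open>G\<close>-orthonormal basis, written into the columns of \<open>P\<close>, satisfies \<open>P\<^sup>T G P = 1\<close>; take \<open>M\<close> to be
  the inverse of \<open>P\<close>. The map \<open>M\<close> turns the norm given by \<open>G\<close> into the Euclidean one.
\<close>

lemma positive_definite_factor:
  fixes G :: "real ^ 'n::finite ^ 'n"
  assumes sym: "transpose G = G" and pos: "\<And>v. v \<noteq> 0 \<Longrightarrow> 0 < v \<bullet> (G *v v)"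
  obtains M :: "real ^ 'n ^ 'n" where "invertible M" "G = transpose M ** M"
proof -
  obtain v :: "'n \<Rightarrow> real ^ 'n"
    where v: "\<And>i j. v i \<bullet> (G *v v j) = (if i = j then 1 else 0)"
    using positive_definite_orthonormal_family[OF sym pos, of UNIV] by blast
  define P :: "real ^ 'n ^ 'n" where "P = (\<chi> r j. v j $ r)"
  have col: "column j P = v j" for j
    by (simp add: column_def P_def vec_eq_iff)
  have P: "transpose P ** (G ** P) = mat 1"
  proof -
    have "(transpose P ** (G ** P)) $ i $ j = v i \<bullet> (G *v v j)" for i j
    proof -
      have "(transpose P ** (G ** P)) $ i $ j = row i (transpose P) \<bullet> column j (G ** P)"
        by (simp add: matrix_mult_dot row_def column_def matrix_matrix_mult_def inner_vec_def)
      also have "row i (transpose P) = v i"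
        by (simp add: row_transpose col)
      also have "column j (G ** P) = G *v v j"
        by (simp add: column_def matrix_matrix_mult_def matrix_vector_mult_def P_def vec_eq_iff)
      finally show ?thesis .
    qed
    then show ?thesis
      by (simp add: v mat_def vec_eq_iff)
  qed
  then have "(transpose P ** G) ** P = mat 1"
    by (simp add: matrix_mul_assoc)
  then have inv: "invertible P"
    using invertible_left_inverse by blast
  then obtain M where MP: "M ** P = mat 1" "P ** M = mat 1"
    using invertible_def by blast
  then have "transpose P ** transpose M = mat 1" "transpose M ** transpose P = mat 1"
    by (metis matrix_transpose_mul transpose_mat)+
  then have "G = transpose M ** (transpose P ** (G ** P)) ** M"
    using MP by (metis matrix_mul_assoc matrix_mul_lid matrix_mul_rid)
  also have "\<dots> = transpose M ** M"
    by (simp add: P)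
  finally have G: "G = transpose M ** M" .
  have "invertible M"
    unfolding invertible_def using MP by (intro exI[of _ P] conjI)
  from that[OF this G] show ?thesis .
qed

lemma positive_definite_det:
  fixes G :: "real ^ 'n::finite ^ 'n"
  assumes "transpose G = G" and "\<And>v. v \<noteq> 0 \<Longrightarrow> 0 < v \<bullet> (G *v v)"
  shows "0 < det G"
proof -
  obtain M :: "real ^ 'n ^ 'n" where "invertible M" "G = transpose M ** M"
    using positive_definite_factor[OF assms] by blast
  then have "det M \<noteq> 0" "det G = det M * det M"
    by (simp_all add: det_mul invertible_det_nz)
  then show ?thesis
    by (metis not_real_square_gt_zero)
qed

section \<open>The Riemannian volume\<close>

lemma chart_props:
  assumes "smooth_atlas A" "c \<in> A"
  shows "open (fst c)" "open (snd c ` fst c)"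
    "homeomorphism (fst c) (snd c ` fst c) (snd c) (chart_inv c)"
    "inj_on (snd c) (fst c)"
proof -
  have "is_chart c"
    using assms by (simp add: smooth_atlas_def)
  then show "open (fst c)" "open (snd c ` fst c)"
    "homeomorphism (fst c) (snd c ` fst c) (snd c) (chart_inv c)"
    by (auto simp: is_chart_def)
  then show "inj_on (snd c) (fst c)"
    by (intro inj_on_inverseI[of _ "chart_inv c"]) (simp add: homeomorphism_def)
qed

lemma chart_open_image:
  assumes "smooth_atlas A" "c \<in> A" "open V" "V \<subseteq> fst c"
  shows "open (snd c ` V)"
proof -
  have "openin (top_of_set (snd c ` fst c)) (snd c ` V)"
    using homeomorphism_imp_open_map[OF chart_props(3)[OF assms(1,2)]] assms
    by (metis openin_open_eq chart_props(1))
  then show ?thesis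
    using chart_props(2)[OF assms(1,2)] openin_open_trans by blast
qed

lemma chart_image_measurable:
  fixes A :: "('a::{second_countable_topology, t2_space}, 'n::finite) chart set"
  assumes "smooth_atlas A" "c \<in> A" "B \<in> sets borel" "B \<subseteq> fst c"
  shows "snd c ` B \<in> sets borel"
proof -
  note c = chart_props[OF assms(1,2)]
  have "(\<lambda>y. chart_inv c y) \<in> borel_measurable (restrict_space borel (snd c ` fst c))"
    using c(3) by (intro borel_measurable_continuous_on_restrict) (auto simp: homeomorphism_def)
  then have "chart_inv c -` B \<inter> space (restrict_space borel (snd c ` fst c))
      \<in> sets (restrict_space borel (snd c ` fst c))"
    using assms(3) measurable_sets by blast
  moreover have "chart_inv c -` B \<inter> space (restrict_space borel (snd c ` fst c)) = snd c ` B"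
    using assms(4) c(4) by (auto simp: space_restrict_space)
  ultimately show ?thesis
    using c(2) by (simp add: sets_restrict_space_iff)
qed

definition chart_density :: "('a, 'n::finite) metric_coeffs \<Rightarrow> ('a, 'n) chart \<Rightarrow> real ^ 'n \<Rightarrow> real" where
  "chart_density g c y = sqrt (det (g c (chart_inv c y)))"

text \<open>
  The value that the Riemannian volume must take on Borel subsets of the domain of \<open>c\<close>.
\<close>

definition chart_volume :: "('a, 'n::finite) metric_coeffs \<Rightarrow> ('a, 'n) chart \<Rightarrow> 'a set \<Rightarrow> ennreal" where
  "chart_volume g c B = (\<integral>\<^sup>+y\<in>snd c ` B. ennreal (chart_density g c y) \<partial>lborel)"

lemma continuous_on_det:
  fixes F :: "'b::topological_space \<Rightarrow> real ^ 'n::finite ^ 'n"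
  assumes "\<And>i j. continuous_on S (\<lambda>y. F y $ i $ j)"
  shows "continuous_on S (\<lambda>y. det (F y))"
  unfolding det_def by (intro continuous_intros assms)

context
  fixes A :: "('a::{second_countable_topology, t2_space}, 'n::finite) chart set"
    and g :: "('a, 'n) metric_coeffs"
  assumes mfd: "riemannian_manifold A g"
begin

lemma atlas: "smooth_atlas A"
  using mfd by (simp add: riemannian_manifold_def)

lemma metric_pd:
  assumes "c \<in> A" "x \<in> fst c"
  shows "transpose (g c x) = g c x" "v \<noteq> 0 \<Longrightarrow> 0 < v \<bullet> (g c x *v v)" "0 < det (g c x)"
proof -
  show sym: "transpose (g c x) = g c x"
    using mfd assms unfolding riemannian_manifold_def riemannian_metric_def by blast
  have pos: "0 < w \<bullet> (g c x *v w)" if "w \<noteq> 0" for w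
    using mfd assms that unfolding riemannian_manifold_def riemannian_metric_def by blast
  then show "v \<noteq> 0 \<Longrightarrow> 0 < v \<bullet> (g c x *v v)"
    by blast
  show "0 < det (g c x)"
    by (rule positive_definite_det[OF sym pos])
qed

lemma continuous_on_metric:
  assumes "c \<in> A"
  shows "continuous_on (snd c ` fst c) (\<lambda>y. g c (chart_inv c y))"
proof -
  have "Ck_on 0 (snd c ` fst c) (\<lambda>y. g c (chart_inv c y))"
    using mfd assms unfolding riemannian_manifold_def riemannian_metric_def smooth_on_def by blast
  then show ?thesis by simp
qed

lemma continuous_on_chart_density:
  assumes "c \<in> A"
  shows "continuous_on (snd c ` fst c) (chart_density g c)"
  unfolding chart_density_def
  by (intro continuous_intros continuous_on_det continuous_on_metric assms)

lemma chart_density_pos: "c \<in> A \<Longrightarrow> y \<in> snd c ` fst c \<Longrightarrow> 0 < chart_density g c y"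
  using metric_pd(3)[of c] chart_props(4)[OF atlas, of c]
  by (auto simp: chart_density_def simp del: split_paired_All)

lemma transition_Ck_1:
  assumes "c \<in> A" "d \<in> A"
  shows "Ck_on 1 (snd c ` (fst c \<inter> fst d)) (snd d \<circ> chart_inv c)"
  using atlas assms unfolding smooth_atlas_def smooth_on_def by blast

lemma transition_derivative:
  assumes "c \<in> A" "d \<in> A" "y \<in> snd c ` (fst c \<inter> fst d)"
  shows "(snd d \<circ> chart_inv c has_derivative
      frechet_derivative (snd d \<circ> chart_inv c) (at y)) (at y)"
  using transition_Ck_1[OF assms(1,2)] assms(3) unfolding One_nat_def Ck_on.simps
  by (blast dest: frechet_derivative_works[THEN iffD1])

lemma transition_continuous_partials:
  assumes "c \<in> A" "d \<in> A"
  shows "continuous_on (snd c ` (fst c \<inter> fst d))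
      (\<lambda>y. frechet_derivative (snd d \<circ> chart_inv c) (at y) (axis i 1))"
  using transition_Ck_1[OF assms] unfolding One_nat_def Ck_on.simps by blast

lemma metric_transform:
  assumes "c \<in> A" "d \<in> A" "x \<in> fst c \<inter> fst d"
  shows "g c x = transpose (transition_jacobian c d x) ** g d x ** transition_jacobian c d x"
  using mfd assms unfolding riemannian_manifold_def riemannian_metric_def by blast

lemma chart_density_measurable:
  assumes "c \<in> A" "B \<in> sets borel" "B \<subseteq> fst c"
  shows "(\<lambda>y. indicator (snd c ` B) y * chart_density g c y) \<in> borel_measurable borel"
proof -
  have "continuous_on (snd c ` B) (chart_density g c)"
    using continuous_on_chart_density assms by (meson continuous_on_subset image_mono)
  from borel_measurable_continuous_on_indicator[OF _ this]
  show ?thesis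
    using chart_image_measurable[OF atlas assms] by simp
qed

text \<open>
  On a common part of two charts the square roots of the Gram determinants differ by the absolute
  Jacobian determinant of the transition map, which is exactly the factor that the change of
  variables formula introduces.
\<close>

lemma chart_volume_eq:
  assumes c: "c \<in> A" and d: "d \<in> A" and B: "B \<in> sets borel" "B \<subseteq> fst c" "B \<subseteq> fst d"
  shows "chart_volume g c B = chart_volume g d B"
proof -
  let ?T = "snd d \<circ> chart_inv c"
  let ?S = "snd c ` B"
  let ?W = "snd c ` (fst c \<inter> fst d)"
  have inv: "chart_inv c (snd c x) = x" "chart_inv d (snd d x) = x" if "x \<in> B" for x
    using that B chart_props(4)[OF atlas] c d by (auto simp: subset_eq)
  have TS: "?T ` ?S = snd d ` B"
    using inv by (force simp: image_image)
  have jac: "chart_density g c (snd c x)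
      = \<bar>det (matrix (frechet_derivative ?T (at (snd c x))))\<bar> * chart_density g d (?T (snd c x))"
    if "x \<in> B" for x
  proof -
    let ?J = "transition_jacobian c d x"
    have "det (g c x) = (det ?J)\<^sup>2 * det (g d x)"
      using metric_transform[OF c d, of x, THEN arg_cong[where f = det]] B that
      by (auto simp: det_mul power2_eq_square mult_ac)
    then have "sqrt (det (g c x)) = \<bar>det ?J\<bar> * sqrt (det (g d x))"
      by (simp add: real_sqrt_mult)
    then show ?thesis
      using inv[OF that] by (simp add: chart_density_def transition_jacobian_def)
  qed
  have SW: "?S \<subseteq> ?W"
    using B by auto
  have "chart_volume g d B = (\<integral>\<^sup>+y\<in>?T ` ?S. ennreal (chart_density g d y) \<partial>lborel)"
    by (simp only: chart_volume_def TS)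
  also have "\<dots> = (\<integral>\<^sup>+y\<in>?S. ennreal (\<bar>det (matrix (frechet_derivative ?T (at y)))\<bar>
      * chart_density g d (?T y)) \<partial>lborel)"
  proof (rule nn_integral_change_of_variables)
    show "?S \<in> sets borel" "?T ` ?S \<in> sets borel"
      using chart_image_measurable[OF atlas] c d B by (auto simp only: TS)
    show "(?T has_derivative frechet_derivative ?T (at y)) (at y within ?S)" if "y \<in> ?S" for y
      using transition_derivative[OF c d] SW that has_derivative_at_withinI by blast
    show "inj_on ?T ?S"
      using inv by (auto simp: inj_on_def) metis
    show "0 \<le> chart_density g d y" if "y \<in> ?T ` ?S" for y
      using chart_density_pos[OF d, of y] that B unfolding TS by force
    show "(\<lambda>y. indicator (?T ` ?S) y * chart_density g d y) \<in> borel_measurable borel"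
      unfolding TS using chart_density_measurable d B by blast
    have "(\<lambda>y. indicator ?S y * (\<bar>det (matrix (frechet_derivative ?T (at y)))\<bar>
        * chart_density g d (?T y))) = (\<lambda>y. indicator ?S y * chart_density g c y)"
      using jac by (auto simp: fun_eq_iff indicator_def)
    then show "(\<lambda>y. indicator ?S y * (\<bar>det (matrix (frechet_derivative ?T (at y)))\<bar>
        * chart_density g d (?T y))) \<in> borel_measurable borel"
      using chart_density_measurable c B by simp
  qed
  also have "\<dots> = chart_volume g c B"
    unfolding chart_volume_def using jac by (intro nn_integral_cong) (auto simp: indicator_def)
  finally show ?thesis ..
qed

lemma chart_volume_suminf:
  assumes c: "c \<in> A" and B: "\<And>i. B i \<in> sets borel" "\<And>i. B i \<subseteq> fst c"
    and disj: "disjoint_family (B :: nat \<Rightarrow> 'a set)"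
  shows "chart_volume g c (\<Union>i. B i) = (\<Sum>i. chart_volume g c (B i))"
proof -
  define M where "M = density lborel (\<lambda>y. ennreal (indicator (snd c ` fst c) y * chart_density g c y))"
  have "(\<lambda>y. indicator (snd c ` fst c) y * chart_density g c y) \<in> borel_measurable borel"
    using c chart_props(1)[OF atlas c] by (intro chart_density_measurable) auto
  then have M: "emeasure M (snd c ` X) = chart_volume g c X" if "X \<in> sets borel" "X \<subseteq> fst c" for X
    unfolding M_def chart_volume_def
    using chart_image_measurable[OF atlas c that] that
    by (subst emeasure_density) (auto intro!: nn_integral_cong simp: indicator_def subset_eq)
  have "disjoint_family (\<lambda>i. snd c ` B i)"
    using disj B chart_props(4)[OF atlas c] unfolding disjoint_family_on_def
    by (metis (no_types, lifting) UNIV_I image_empty inj_on_image_Int)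
  then have "(\<Sum>i. emeasure M (snd c ` B i)) = emeasure M (\<Union>i. snd c ` B i)"
    using chart_image_measurable[OF atlas c B] by (intro suminf_emeasure) (auto simp: M_def)
  also have "(\<Union>i. snd c ` B i) = snd c ` (\<Union>i. B i)"
    by auto
  finally show ?thesis
    using M B by (simp add: UN_subset_iff)
qed

text \<open>
  Second countability reduces the atlas to countably many charts; their domains are then made
  disjoint, so that every Borel set splits into pieces that each lie in one chart.
\<close>

lemma countable_disjoint_charts:
  obtains C :: "nat \<Rightarrow> ('a, 'n) chart" and D :: "nat \<Rightarrow> 'a set"
  where "\<And>i. C i \<in> A" "\<And>i. D i \<in> sets borel" "\<And>i. D i \<subseteq> fst (C i)"
    "disjoint_family D" "(\<Union>i. D i) = UNIV"
proof -
  have "\<And>S. S \<in> fst ` A \<Longrightarrow> open S"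
    using chart_props(1)[OF atlas] by auto
  then obtain F where F: "F \<subseteq> fst ` A" "countable F" "\<Union>F = \<Union>(fst ` A)"
    by (rule Lindelof)
  moreover have cover: "\<Union>(fst ` A) = UNIV"
    using atlas by (auto simp: smooth_atlas_def)
  ultimately have "F \<noteq> {}"
    by auto
  then obtain U :: "nat \<Rightarrow> 'a set" where U: "range U = F"
    using F(2) range_from_nat_into by metis
  then have "\<forall>i. \<exists>c\<in>A. fst c = U i"
    using F(1) by (metis imageE rangeI subsetD)
  then obtain C where C: "\<And>i. C i \<in> A" "\<And>i. fst (C i) = U i"
    by metis
  show ?thesis
  proof (rule that[of C "disjointed U"])
    have "range U \<subseteq> sets borel"
      using chart_props(1)[OF atlas C(1)] C(2) by (metis borel_open image_subsetI)
    from sets.range_disjointed_sets[OF this] show "disjointed U i \<in> sets borel" for i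
      by auto
    show "disjointed U i \<subseteq> fst (C i)" for i
      using C(2) disjointed_subset by metis
    show "(\<Union>i. disjointed U i) = UNIV"
      using UN_disjointed_eq[of U] U F cover by simp
  qed (use C disjoint_family_disjointed in auto)
qed

text \<open>
  Existence: add up the chart volumes of the pieces of a set; consistency of the charts shows that
  the sum gives the right value on each chart domain. Uniqueness: the pieces determine the measure
  by countable additivity.
\<close>

lemma riem_volume_unique_exists:
  "\<exists>!\<mu>. sets \<mu> = sets borel \<and>
     (\<forall>c\<in>A. \<forall>B\<in>sets borel. B \<subseteq> fst c \<longrightarrow> emeasure \<mu> B = chart_volume g c B)"
proof -
  obtain C :: "nat \<Rightarrow> ('a, 'n) chart" and D :: "nat \<Rightarrow> 'a set"
    where C: "\<And>i. C i \<in> A" and D: "\<And>i. D i \<in> sets borel" "\<And>i. D i \<subseteq> fst (C i)"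
      "disjoint_family D" "(\<Union>i. D i) = UNIV"
    by (rule countable_disjoint_charts) blast
  have split: "(\<Union>i. B \<inter> D i) = B" "disjoint_family (\<lambda>i. B \<inter> D i)" for B
    using D(3,4) by (auto simp: disjoint_family_on_def)
  \<comment> \<open>The sum over the pieces is written as an integral for the counting measure, so that
    monotone convergence exchanges it with the countable union.\<close>
  define m where "m B = (\<integral>\<^sup>+i. chart_volume g (C i) (B \<inter> D i) \<partial>count_space UNIV)" for B
  define \<mu> where "\<mu> = measure_of UNIV (sets borel) m"
  have "countably_additive (sets borel) m"
  proof (rule countably_additiveI)
    fix B :: "nat \<Rightarrow> 'a set"
    assume B: "range B \<subseteq> sets borel" "disjoint_family B" "(\<Union>i. B i) \<in> sets borel"
    have "m (\<Union>k. B k) = (\<integral>\<^sup>+i. chart_volume g (C i) (\<Union>k. B k \<inter> D i) \<partial>count_space UNIV)"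
      unfolding m_def by (intro nn_integral_cong arg_cong[where f = "chart_volume g _"]) auto
    also have "\<dots> = (\<integral>\<^sup>+i. (\<Sum>k. chart_volume g (C i) (B k \<inter> D i)) \<partial>count_space UNIV)"
      using B(1,2) C D by (intro nn_integral_cong chart_volume_suminf)
        (auto simp: disjoint_family_on_def subset_eq)
    also have "\<dots> = (\<Sum>k. m (B k))"
      unfolding m_def by (rule nn_integral_suminf) auto
    finally show "(\<Sum>k. m (B k)) = m (\<Union>k. B k)" ..
  qed
  moreover have "positive (sets borel) m"
    by (simp add: positive_def m_def chart_volume_def)
  ultimately have \<mu>: "emeasure \<mu> B = m B" if "B \<in> sets borel" for B
    unfolding \<mu>_def using that sets.sigma_algebra_axioms[of "borel :: 'a measure"]
    by (intro emeasure_measure_of_sigma) auto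
  have sets: "sets \<mu> = sets borel"
    unfolding \<mu>_def using sets.sigma_sets_eq[of "borel :: 'a measure"] by (simp add: sets_measure_of_conv)
  have chart: "emeasure \<mu> B = chart_volume g c B"
    if "c \<in> A" "B \<in> sets borel" "B \<subseteq> fst c" for c B
  proof -
    have "emeasure \<mu> B = (\<Sum>i. chart_volume g (C i) (B \<inter> D i))"
      using that by (simp add: \<mu> m_def nn_integral_count_space_nat)
    also have "\<dots> = (\<Sum>i. chart_volume g c (B \<inter> D i))"
      using that C D by (intro suminf_cong chart_volume_eq) (auto simp: subset_eq)
    also have "\<dots> = chart_volume g c (\<Union>i. B \<inter> D i)"
      using that D split(2) by (intro chart_volume_suminf[symmetric]) auto
    finally show ?thesis
      by (simp only: split)
  qed
  have unique: "\<mu>' = \<mu>" if sets': "sets \<mu>' = sets borel"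
    and \<mu>': "\<forall>c\<in>A. \<forall>B\<in>sets borel. B \<subseteq> fst c \<longrightarrow> emeasure \<mu>' B = chart_volume g c B" for \<mu>'
  proof (rule measure_eqI)
    fix B assume "B \<in> sets \<mu>'"
    then have B: "B \<in> sets borel"
      by (simp add: sets')
    have BD: "range (\<lambda>i. B \<inter> D i) \<subseteq> sets borel"
      using B D(1) by (intro image_subsetI sets.Int)
    have "emeasure \<mu>' B = (\<Sum>i. emeasure \<mu>' (B \<inter> D i))"
      using suminf_emeasure[of "\<lambda>i. B \<inter> D i" \<mu>'] split BD sets' by simp
    also have "\<dots> = (\<Sum>i. emeasure \<mu> (B \<inter> D i))"
    proof (rule suminf_cong)
      fix i
      have "B \<inter> D i \<in> sets borel" "B \<inter> D i \<subseteq> fst (C i)"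
        using BD D(2) by auto
      then show "emeasure \<mu>' (B \<inter> D i) = emeasure \<mu> (B \<inter> D i)"
        using \<mu>' chart C by metis
    qed
    also have "\<dots> = emeasure \<mu> B"
      using suminf_emeasure[of "\<lambda>i. B \<inter> D i" \<mu>] split BD sets by simp
    finally show "emeasure \<mu>' B = emeasure \<mu> B" .
  qed (simp add: sets sets')
  show ?thesis
  proof (rule ex1I[of _ \<mu>])
    show "sets \<mu> = sets borel \<and>
        (\<forall>c\<in>A. \<forall>B\<in>sets borel. B \<subseteq> fst c \<longrightarrow> emeasure \<mu> B = chart_volume g c B)"
      using sets chart by blast
  qed (use unique in blast)
qed

lemma sets_riem_volume: "sets (riem_volume A g) = sets borel"
  and emeasure_riem_volume: "c \<in> A \<Longrightarrow> B \<in> sets borel \<Longrightarrow> B \<subseteq> fst c \<Longrightarrow>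
    emeasure (riem_volume A g) B = chart_volume g c B"
proof -
  have "riem_volume A g = (THE \<mu>. sets \<mu> = sets borel \<and>
     (\<forall>c\<in>A. \<forall>B\<in>sets borel. B \<subseteq> fst c \<longrightarrow> emeasure \<mu> B = chart_volume g c B))"
    by (simp only: riem_volume_def chart_volume_def chart_density_def)
  with theI'[OF riem_volume_unique_exists]
  have *: "sets (riem_volume A g) = sets borel \<and> (\<forall>c\<in>A. \<forall>B\<in>sets borel. B \<subseteq> fst c \<longrightarrow>
      emeasure (riem_volume A g) B = chart_volume g c B)"
    by simp
  then show "sets (riem_volume A g) = sets borel"
    by blast
  show "c \<in> A \<Longrightarrow> B \<in> sets borel \<Longrightarrow> B \<subseteq> fst c \<Longrightarrow>
    emeasure (riem_volume A g) B = chart_volume g c B"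
    using * by blast
qed

end

section \<open>Gradients of functions supported in a chart\<close>

lemma matrix_inv_right:
  fixes G :: "real ^ 'n::finite ^ 'n"
  assumes "det G \<noteq> 0"
  shows "G *v (matrix_inv G *v w) = w"
proof -
  have "\<exists>B. G ** B = mat 1 \<and> B ** G = mat 1"
    using assms by (simp flip: invertible_def add: invertible_det_nz)
  then have "G ** matrix_inv G = mat 1"
    unfolding matrix_inv_def by (rule someI2_ex) simp
  then show ?thesis
    by (simp add: matrix_vector_mul_assoc)
qed

lemma chart_at:
  fixes A :: "('a::{second_countable_topology, t2_space}, 'n::finite) chart set"
  assumes mfd: "riemannian_manifold A g"
  shows "chart_at A x \<in> A" "x \<in> fst (chart_at A x)"
proof -
  have "\<exists>d. d \<in> A \<and> x \<in> fst d"
    using atlas[OF mfd] unfolding smooth_atlas_def by blast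
  then have "chart_at A x \<in> A \<and> x \<in> fst (chart_at A x)"
    unfolding chart_at_def by (rule someI_ex)
  then show "chart_at A x \<in> A" "x \<in> fst (chart_at A x)"
    by auto
qed

lemma gradient_norm_nonneg:
  fixes A :: "('a::{second_countable_topology, t2_space}, 'n::finite) chart set"
  assumes mfd: "riemannian_manifold A g"
  shows "0 \<le> gradient_norm A g f x"
proof -
  have "0 \<le> v \<bullet> (g (chart_at A x) x *v v)" for v
    using metric_pd(2)[OF mfd chart_at[OF mfd], of v x] by (cases "v = 0") auto
  then show ?thesis
    by (simp add: gradient_norm_def metric_norm_def Let_def)
qed

text \<open>
  A \<open>C\<^sup>1\<close> function \<open>F\<close> on the coordinate space with compact support \<open>Z\<close> in the image of the chart \<open>c\<close>,
  pulled back to the manifold and extended by zero. Since the manifold is Hausdorff, the support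
  of the pullback \<open>f\<close> is closed, and every point has a neighbourhood on which \<open>f\<close> either is read off
  in the chart \<open>c\<close> or vanishes.
\<close>

locale chart_function =
  fixes A :: "('a::{second_countable_topology, t2_space}, 'n::finite) chart set"
    and g :: "('a, 'n) metric_coeffs" and c :: "('a, 'n) chart"
    and F :: "real ^ 'n \<Rightarrow> real" and F' :: "real ^ 'n \<Rightarrow> real ^ 'n \<Rightarrow> real" and Z :: "(real ^ 'n) set"
    and f :: "'a \<Rightarrow> real"
  assumes mfd: "riemannian_manifold A g" and c: "c \<in> A"
    and deriv: "\<And>y. (F has_derivative F' y) (at y)"
    and cont: "\<And>i. continuous_on UNIV (\<lambda>y. F' y (axis i 1))"
    and Z: "compact Z" "Z \<subseteq> snd c ` fst c"
    and F0: "\<And>y. y \<notin> Z \<Longrightarrow> F y = 0"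
    and f: "\<And>x. f x = (if x \<in> fst c then F (snd c x) else 0)"
begin

definition support where "support = chart_inv c ` Z"

lemma support: "compact support" "closed support" "support \<subseteq> fst c"
proof -
  have "continuous_on Z (chart_inv c)"
    using chart_props(3)[OF atlas[OF mfd] c] Z(2)
    by (meson continuous_on_subset homeomorphism_cont2)
  then show "compact support"
    unfolding support_def using Z(1) by (rule compact_continuous_image)
  then show "closed support"
    by (rule compact_imp_closed)
  show "support \<subseteq> fst c"
    using Z(2) by (auto simp: support_def inv_into_into)
qed

lemma f_zero:
  assumes "x \<notin> support"
  shows "f x = 0"
proof (cases "x \<in> fst c")
  case True
  then have "chart_inv c (snd c x) = x"
    using chart_props(4)[OF atlas[OF mfd] c] by simp
  then have "snd c x \<notin> Z"
    using assms unfolding support_def by (metis imageI)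
  then show ?thesis
    by (simp add: f F0)
qed (simp add: f)

lemma F'_zero: "y \<notin> Z \<Longrightarrow> F' y = (\<lambda>h. 0)"
proof -
  assume y: "y \<notin> Z"
  have "((\<lambda>_. 0) has_derivative F' y) (at y)"
    by (rule has_derivative_transform_within_open[OF deriv, of "- Z"])
       (use y F0 Z(1) compact_imp_closed in auto)
  then show ?thesis
    using has_derivative_unique[OF _ has_derivative_const] by blast
qed

definition L :: "('a, 'n) chart \<Rightarrow> real ^ 'n \<Rightarrow> real ^ 'n \<Rightarrow> real" where
  "L d y = (if chart_inv d y \<in> fst c
    then \<lambda>h. F' (snd c (chart_inv d y)) (frechet_derivative (snd c \<circ> chart_inv d) (at y) h)
    else (\<lambda>h. 0))"

lemma has_derivative_chart:
  assumes d: "d \<in> A" and x: "x \<in> fst d"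
  shows "(f \<circ> chart_inv d has_derivative L d (snd d x)) (at (snd d x))"
proof -
  have inv: "chart_inv d (snd d z) = z" if "z \<in> fst d" for z
    using that chart_props(4)[OF atlas[OF mfd] d] by simp
  show ?thesis
  proof (cases "x \<in> fst c")
    case True
    let ?V = "snd d ` (fst d \<inter> fst c)"
    have "open ?V"
      using chart_open_image[OF atlas[OF mfd] d] chart_props(1)[OF atlas[OF mfd]] c d by blast
    moreover have "snd d x \<in> ?V"
      using True x by blast
    moreover have "(F \<circ> (snd c \<circ> chart_inv d) has_derivative
        F' ((snd c \<circ> chart_inv d) (snd d x)) \<circ> frechet_derivative (snd c \<circ> chart_inv d) (at (snd d x)))
        (at (snd d x))"
      by (rule diff_chain_at[OF transition_derivative[OF mfd d c \<open>snd d x \<in> ?V\<close>] deriv])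
    then have "(F \<circ> (snd c \<circ> chart_inv d) has_derivative L d (snd d x)) (at (snd d x))"
      using True inv[OF x] by (simp add: L_def comp_def)
    ultimately show ?thesis
      using inv by (elim has_derivative_transform_within_open) (auto simp: f)
  next
    case False
    let ?V = "snd d ` (fst d - support)"
    have "open ?V"
      using chart_open_image[OF atlas[OF mfd] d] chart_props(1)[OF atlas[OF mfd] d] support(2) by blast
    moreover have "snd d x \<in> ?V"
      using False x support(3) by blast
    moreover have "((\<lambda>_. 0) has_derivative L d (snd d x)) (at (snd d x))"
      using False inv[OF x] by (simp add: L_def)
    ultimately show ?thesis
      using inv f_zero by (elim has_derivative_transform_within_open) auto
  qed
qed

lemma continuous_on_chart_derivative:
  assumes d: "d \<in> A"
  shows "continuous_on (snd d ` fst d) (\<lambda>y. L d y (axis i 1))"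
proof -
  have inv: "chart_inv d (snd d z) = z" if "z \<in> fst d" for z
    using that chart_props(4)[OF atlas[OF mfd] d] by simp
  let ?V = "snd d ` (fst d \<inter> fst c)" and ?W = "snd d ` (fst d - support)"
  let ?T = "snd c \<circ> chart_inv d"
  have open_VW: "open ?V" "open ?W"
    using chart_open_image[OF atlas[OF mfd] d] chart_props(1)[OF atlas[OF mfd]] c d support(2)
    by blast+
  have T: "continuous_on ?V ?T"
    using transition_derivative[OF mfd d c] has_derivative_continuous
    by (meson continuous_at_imp_continuous_on)
  have lin: "F' z h = (\<Sum>j\<in>UNIV. h $ j * F' z (axis j 1))" for z h
  proof -
    have "linear (F' z)"
      using deriv has_derivative_linear by blast
    then have "F' z (\<Sum>j\<in>UNIV. h $ j *\<^sub>R axis j 1) = (\<Sum>j\<in>UNIV. h $ j * F' z (axis j 1))"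
      by (simp add: linear_sum linear_cmul)
    then show ?thesis
      by (simp add: basis_expansion flip: scalar_mult_eq_scaleR)
  qed
  have "continuous_on ?V (\<lambda>y. F' (?T y) (axis j 1))" for j
    using continuous_on_compose[OF T continuous_on_subset[OF cont[of j]]] by (simp add: comp_def)
  then have "continuous_on ?V (\<lambda>y. \<Sum>j\<in>UNIV. frechet_derivative ?T (at y) (axis i 1) $ j
      * F' (?T y) (axis j 1))"
    by (intro continuous_intros transition_continuous_partials[OF mfd d c]) auto
  then have "continuous_on ?V (\<lambda>y. L d y (axis i 1))"
  proof (rule continuous_on_eq)
    fix y assume "y \<in> ?V"
    then have "L d y (axis i 1) = F' (?T y) (frechet_derivative ?T (at y) (axis i 1))"
      using inv by (auto simp: L_def)
    then show "(\<Sum>j\<in>UNIV. frechet_derivative ?T (at y) (axis i 1) $ j * F' (?T y) (axis j 1))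
        = L d y (axis i 1)"
      by (subst (asm) lin) simp
  qed
  moreover have "continuous_on ?W (\<lambda>y. L d y (axis i 1))"
  proof (rule continuous_on_eq[OF continuous_on_const[of _ 0]])
    fix y assume "y \<in> ?W"
    then obtain x where x: "x \<in> fst d" "x \<notin> support" "y = snd d x"
      by blast
    have "snd c x \<notin> Z" if "x \<in> fst c"
      using x(2) that chart_props(4)[OF atlas[OF mfd] c]
      by (auto simp: support_def image_iff)
    then show "0 = L d y (axis i 1)"
      using x inv[OF x(1)] by (simp add: L_def F'_zero)
  qed
  ultimately have "continuous_on (?V \<union> ?W) (\<lambda>y. L d y (axis i 1))"
    using open_VW by (intro continuous_on_open_Un)
  moreover have "?V \<union> ?W = snd d ` fst d"
    using support(3) by blast
  ultimately show ?thesis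
    by simp
qed

lemma in_C01:
  assumes "Z \<subseteq> snd c ` (fst c \<inter> \<Omega>)"
  shows "f \<in> C01 A \<Omega>"
proof -
  have "Ck_on 1 (snd d ` (fst d \<inter> \<Omega>)) (f \<circ> chart_inv d)" if d: "d \<in> A" for d
  proof -
    have D: "(f \<circ> chart_inv d has_derivative L d y) (at y)" if "y \<in> snd d ` (fst d \<inter> \<Omega>)" for y
      using has_derivative_chart[OF d] that by blast
    have "continuous_on (snd d ` (fst d \<inter> \<Omega>))
        (\<lambda>y. frechet_derivative (f \<circ> chart_inv d) (at y) (axis i 1))" for i
    proof (rule continuous_on_eq)
      show "continuous_on (snd d ` (fst d \<inter> \<Omega>)) (\<lambda>y. L d y (axis i 1))"
        using continuous_on_chart_derivative[OF d] by (rule continuous_on_subset) auto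
      show "L d y (axis i 1) = frechet_derivative (f \<circ> chart_inv d) (at y) (axis i 1)"
        if "y \<in> snd d ` (fst d \<inter> \<Omega>)" for y
        using frechet_derivative_at[OF D[OF that]] by simp
    qed
    moreover have "\<forall>y\<in>snd d ` (fst d \<inter> \<Omega>). f \<circ> chart_inv d differentiable at y"
      using D unfolding differentiable_def by blast
    ultimately show ?thesis
      unfolding One_nat_def Ck_on.simps by blast
  qed
  moreover have "support \<subseteq> \<Omega>"
    using assms chart_props(4)[OF atlas[OF mfd] c] by (force simp: support_def)
  ultimately show ?thesis
    unfolding C01_def using support(1) f_zero by auto
qed

lemma gradient_norm_outside:
  assumes "x \<notin> fst c"
  shows "gradient_norm A g f x = 0"
proof -
  let ?d = "chart_at A x"
  note d = chart_at[OF mfd, of x]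
  have "frechet_derivative (f \<circ> chart_inv ?d) (at (snd ?d x)) = L ?d (snd ?d x)"
    using frechet_derivative_at[OF has_derivative_chart[OF d]] by simp
  also have "\<dots> = (\<lambda>h. 0)"
    using assms d chart_props(4)[OF atlas[OF mfd] d(1)] by (simp add: L_def)
  finally have "coord_gradient g ?d f x = matrix_inv (g ?d x) *v 0"
    by (simp add: coord_gradient_def zero_vec_def)
  then show ?thesis
    by (simp add: gradient_norm_def metric_norm_def Let_def)
qed

text \<open>
  The norm of the gradient is defined in an arbitrarily chosen chart \<open>d\<close> around the point. With \<open>J\<close> the
  Jacobian of the transition map from \<open>d\<close> to \<open>c\<close>, the gradient \<open>u\<close> in \<open>d\<close> corresponds to the vector \<open>J u\<close> in \<open>c\<close>,
  which has the same length and solves the defining equation of the gradient in \<open>c\<close>. The vector is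
  only characterised by that equation, so that no inverse matrix enters later estimates.
\<close>

lemma gradient_norm_inside:
  assumes x: "x \<in> fst c"
  obtains v where "g c x *v v = (\<chi> i. F' (snd c x) (axis i 1))"
    and "gradient_norm A g f x = sqrt (v \<bullet> (g c x *v v))"
proof -
  let ?d = "chart_at A x"
  let ?w = "\<chi> i. F' (snd c x) (axis i 1)"
  note d = chart_at[OF mfd, of x]
  define J where "J = transition_jacobian ?d c x"
  have inv: "chart_inv ?d (snd ?d x) = x"
    using d chart_props(4)[OF atlas[OF mfd] d(1)] by simp
  have lin: "linear (F' (snd c x))"
    using deriv has_derivative_linear by blast
  have F'_w: "F' (snd c x) h = ?w \<bullet> h" for h
  proof -
    have "F' (snd c x) (\<Sum>j\<in>UNIV. h $ j *\<^sub>R axis j 1) = (\<Sum>j\<in>UNIV. h $ j * F' (snd c x) (axis j 1))"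
      using lin by (simp add: linear_sum linear_cmul)
    then show ?thesis
      by (simp add: basis_expansion inner_vec_def mult.commute flip: scalar_mult_eq_scaleR)
  qed
  have "linear (frechet_derivative (snd c \<circ> chart_inv ?d) (at (snd ?d x)))"
    using transition_derivative[OF mfd d(1) c, of "snd ?d x"] d x has_derivative_linear by blast
  then have J: "frechet_derivative (snd c \<circ> chart_inv ?d) (at (snd ?d x)) h = J *v h" for h
    by (simp add: J_def transition_jacobian_def matrix_works)
  have "(\<chi> i. frechet_derivative (f \<circ> chart_inv ?d) (at (snd ?d x)) (axis i 1)) = transpose J *v ?w"
  proof -
    have "frechet_derivative (f \<circ> chart_inv ?d) (at (snd ?d x)) = L ?d (snd ?d x)"
      using frechet_derivative_at[OF has_derivative_chart[OF d]] by simp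
    also have "\<dots> = (\<lambda>h. F' (snd c x) (J *v h))"
      using inv x by (simp add: L_def J)
    also have "\<dots> = (\<lambda>h. ?w \<bullet> (J *v h))"
      by (rule ext) (rule F'_w)
    also have "\<dots> = (\<lambda>h. (transpose J *v ?w) \<bullet> h)"
      by (simp only: dot_lmul_matrix transpose_matrix_vector)
    finally show ?thesis
      by (simp add: vec_eq_iff inner_axis)
  qed
  then have grad: "coord_gradient g ?d f x = matrix_inv (g ?d x) *v (transpose J *v ?w)"
    by (simp add: coord_gradient_def)
  define u where "u = coord_gradient g ?d f x"
  have gu: "g ?d x *v u = transpose J *v ?w"
    unfolding u_def grad using metric_pd(3)[OF mfd d] by (intro matrix_inv_right) simp
  have gJ: "g ?d x = transpose J ** g c x ** J"
    unfolding J_def using metric_transform[OF mfd d(1) c] d x by blast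
  then have "det J \<noteq> 0"
    using metric_pd(3)[OF mfd d] by (auto simp: det_mul)
  then have "det (transpose J) \<noteq> 0"
    by simp
  then have inj: "inj ((*v) (transpose J))"
    by (simp add: invertible_det_nz inj_matrix_vector_mult)
  \<comment> \<open>Cancelling the invertible matrix \<open>J\<^sup>T\<close> shows that \<open>J u\<close> is the gradient in the chart \<open>c\<close>.\<close>
  have "transpose J *v (g c x *v (J *v u)) = transpose J *v ?w"
    using gu by (simp add: gJ matrix_vector_mul_assoc matrix_mul_assoc)
  then have eq: "g c x *v (J *v u) = ?w"
    by (rule injD[OF inj])
  have "gradient_norm A g f x = sqrt (u \<bullet> (g ?d x *v u))"
    by (simp add: gradient_norm_def metric_norm_def Let_def u_def)
  also have "u \<bullet> (g ?d x *v u) = (J *v u) \<bullet> ?w"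
    unfolding gu by (metis dot_lmul_matrix inner_commute vector_transpose_matrix)
  finally have "gradient_norm A g f x = sqrt ((J *v u) \<bullet> (g c x *v (J *v u)))"
    by (simp only: eq)
  with eq show ?thesis
    by (rule that)
qed

end

section \<open>Ellipsoids and nearly constant metrics\<close>

lemma continuous_on_matrix_diff [continuous_intros]:
  fixes M :: "real ^ 'n::finite ^ 'n"
  assumes "continuous_on S h"
  shows "continuous_on S (\<lambda>y. M *v (h y - y0))"
  by (rule continuous_on_compose2[OF linear_continuous_on[OF matrix_vector_mul_bounded_linear]])
     (auto intro!: continuous_intros assms)

lemma emeasure_spherical_shell:
  assumes "0 \<le> s" "s \<le> r"
  shows "emeasure lborel {z :: real ^ 'n::finite. s \<le> norm z \<and> norm z \<le> r}
    = ennreal (measure lborel (ball (0 :: real ^ 'n) 1) * (r ^ CARD('n) - s ^ CARD('n)))"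
proof -
  let ?\<nu> = "measure lborel (ball (0 :: real ^ 'n) 1)"
  have \<nu>: "?\<nu> = unit_ball_vol (real CARD('n))"
    by (simp add: content_ball)
  have "{z :: real ^ 'n. s \<le> norm z \<and> norm z \<le> r} = cball 0 r - ball 0 s"
    by auto
  also have "emeasure lborel (cball 0 r - ball 0 s :: (real ^ 'n) set)
      = emeasure lborel (cball 0 r :: (real ^ 'n) set) - emeasure lborel (ball 0 s :: (real ^ 'n) set)"
    using assms by (intro emeasure_Diff) (auto simp: emeasure_ball)
  also have "\<dots> = ennreal (?\<nu> * r ^ CARD('n)) - ennreal (?\<nu> * s ^ CARD('n))"
    using assms by (simp add: \<nu> emeasure_ball emeasure_cball)
  also have "\<dots> = ennreal (?\<nu> * (r ^ CARD('n) - s ^ CARD('n)))"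
    using assms by (simp add: ennreal_minus algebra_simps)
  finally show ?thesis .
qed

lemma emeasure_ellipsoidal_shell:
  fixes M :: "real ^ 'n::finite ^ 'n"
  assumes "invertible M" "0 \<le> s" "s \<le> r"
  shows "ennreal \<bar>det M\<bar> * emeasure lborel {y. s \<le> norm (M *v (y - y0)) \<and> norm (M *v (y - y0)) \<le> r}
    = ennreal (measure lborel (ball (0 :: real ^ 'n) 1) * (r ^ CARD('n) - s ^ CARD('n)))"
proof -
  let ?T = "\<lambda>y. M *v (y - y0)"
  let ?S = "{y. s \<le> norm (?T y) \<and> norm (?T y) \<le> r}"
  obtain N where N: "M ** N = mat 1" "N ** M = mat 1"
    using assms(1) invertible_def by blast
  have TS: "?T ` ?S = {z. s \<le> norm z \<and> norm z \<le> r}"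
  proof -
    have T: "?T (N *v z + y0) = z" for z
      using N(1) by (simp add: matrix_vector_mul_assoc)
    have "z \<in> ?T ` ?S" if "s \<le> norm z" "norm z \<le> r" for z
      by (rule image_eqI[of _ _ "N *v z + y0"]) (use that in \<open>simp_all only: T mem_Collect_eq\<close>)
    then show ?thesis
      by blast
  qed
  have S: "?S \<in> sets borel"
    by (intro borel_closed closed_Collect_conj closed_Collect_le continuous_intros)
  have TSb: "{z :: real ^ 'n. s \<le> norm z \<and> norm z \<le> r} \<in> sets borel"
    by (intro borel_closed closed_Collect_conj closed_Collect_le continuous_intros)
  have "(\<integral>\<^sup>+z\<in>?T ` ?S. ennreal 1 \<partial>lborel) = (\<integral>\<^sup>+y\<in>?S. ennreal (\<bar>det (matrix ((*v) M))\<bar> * 1) \<partial>lborel)"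
  proof (rule nn_integral_change_of_variables)
    show "(?T has_derivative (*v) M) (at y within ?S)" for y
      by (auto intro!: derivative_eq_intros
          bounded_linear.has_derivative[OF matrix_vector_mul_bounded_linear])
    show "inj_on ?T ?S"
      using injD[OF inj_matrix_vector_mult[OF assms(1)]] by (fastforce intro: inj_onI)
  qed (use S TSb in \<open>auto simp only: TS intro!: borel_measurable_times\<close>, auto)
  then show ?thesis
    unfolding TS using emeasure_spherical_shell[OF assms(2,3), where 'n = 'n] S TSb
    by (simp add: nn_integral_cmult_indicator)
qed

text \<open>
  Both bounds are continuity of the metric at \<open>x0\<close>. For the comparison of quadratic forms, entries of
  \<open>g c x0 - g c x\<close> below \<open>\<eta>\<close> change the form by at most \<open>n\<^sup>2 \<eta> \<bar>v\<bar>\<^sup>2\<close>, and \<open>\<bar>v\<bar>\<close> is at most a constant \<open>B\<close>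
  times \<open>\<bar>M v\<bar>\<close>.
\<close>

lemma near_constant_metric:
  fixes A :: "('a::{second_countable_topology, t2_space}, 'n::finite) chart set"
  assumes mfd: "riemannian_manifold A g" and c: "c \<in> A" and x0: "x0 \<in> fst c" "x0 \<in> \<Omega>"
    and \<Omega>: "open \<Omega>" and \<epsilon>: "0 < \<epsilon>"
    and M: "invertible M" "g c x0 = transpose M ** M"
  obtains R where "0 < R"
    and "\<And>y. norm (M *v (y - snd c x0)) \<le> R \<Longrightarrow> y \<in> snd c ` (fst c \<inter> \<Omega>)"
    and "\<And>y v. norm (M *v (y - snd c x0)) \<le> R \<Longrightarrow>
      (norm (M *v v))\<^sup>2 \<le> (1 + \<epsilon>)\<^sup>2 * (v \<bullet> (g c (chart_inv c y) *v v))"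
    and "\<And>y. norm (M *v (y - snd c x0)) \<le> R \<Longrightarrow>
      \<bar>chart_density g c y - \<bar>det M\<bar>\<bar> \<le> \<epsilon> * \<bar>det M\<bar>"
proof -
  let ?y0 = "snd c x0" and ?W = "snd c ` (fst c \<inter> \<Omega>)"
  define \<gamma> where "\<gamma> y = g c (chart_inv c y)" for y
  obtain N where N: "N ** M = mat 1"
    using M(1) invertible_def by blast
  have inv: "chart_inv c ?y0 = x0"
    using x0(1) chart_props(4)[OF atlas[OF mfd] c] by simp
  have openW: "open ?W"
    using chart_open_image[OF atlas[OF mfd] c] chart_props(1)[OF atlas[OF mfd] c] \<Omega> by blast
  have detM: "0 < \<bar>det M\<bar>"
    using M(1) by (simp add: invertible_det_nz)
  obtain B where B: "0 < B" "\<And>x. norm (N *v x) \<le> B * norm x"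
    using linear_bounded_pos[OF matrix_vector_mul_linear[of N]] by blast
  have NB: "norm x \<le> B * norm (M *v x)" for x
    using B(2)[of "M *v x"] N by (simp add: matrix_vector_mul_assoc)
  define k where "k = real CARD('n) * real CARD('n)"
  have k: "0 < k"
    by (simp add: k_def)
  \<comment> \<open>With this choice the quadratic forms differ by at most \<open>\<epsilon> / (1 + \<epsilon>) \<bar>M v\<bar>\<^sup>2\<close>, which leaves at
    least \<open>\<bar>M v\<bar>\<^sup>2 / (1 + \<epsilon>)\<close> for the metric at the nearby point.\<close>
  define \<eta> where "\<eta> = \<epsilon> / ((1 + \<epsilon>) * k * B\<^sup>2)"
  have \<eta>: "0 < \<eta>" "k * \<eta> * B\<^sup>2 = \<epsilon> / (1 + \<epsilon>)"
    using \<epsilon> k B(1) by (simp_all add: \<eta>_def)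
  have y0: "?y0 \<in> ?W" "?y0 \<in> snd c ` fst c"
    using x0 by auto
  have open_c: "open (snd c ` fst c)"
    using chart_props(2)[OF atlas[OF mfd] c] .
  have "isCont \<gamma> ?y0" "isCont (chart_density g c) ?y0"
    using continuous_on_metric[OF mfd c] continuous_on_chart_density[OF mfd c] open_c y0(2)
    unfolding \<gamma>_def continuous_on_eq_continuous_at[OF open_c] by blast+
  moreover have "chart_density g c ?y0 = \<bar>det M\<bar>"
    by (simp add: chart_density_def inv M(2) det_mul)
  ultimately have "\<forall>\<^sub>F y in nhds ?y0. dist (\<gamma> y) (\<gamma> ?y0) < \<eta>"
    "\<forall>\<^sub>F y in nhds ?y0. dist (chart_density g c y) \<bar>det M\<bar> < \<epsilon> * \<bar>det M\<bar>"
    using \<eta>(1) \<epsilon> detM by (auto simp: isCont_def tendsto_iff eventually_nhds_conv_at simp del: zero_less_abs_iff)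
  moreover have "\<forall>\<^sub>F y in nhds ?y0. y \<in> ?W"
    using openW y0(1) eventually_nhds by blast
  ultimately have "\<forall>\<^sub>F y in nhds ?y0. y \<in> ?W \<and> dist (\<gamma> y) (\<gamma> ?y0) < \<eta> \<and>
      dist (chart_density g c y) \<bar>det M\<bar> < \<epsilon> * \<bar>det M\<bar>"
    by eventually_elim simp
  then obtain \<delta> where \<delta>: "0 < \<delta>" and near: "\<And>y. dist y ?y0 < \<delta> \<Longrightarrow> y \<in> ?W \<and>
      dist (\<gamma> y) (\<gamma> ?y0) < \<eta> \<and> dist (chart_density g c y) \<bar>det M\<bar> < \<epsilon> * \<bar>det M\<bar>"
    unfolding eventually_nhds_metric by blast
  define R where "R = \<delta> / (2 * B)"
  have dist: "dist y ?y0 < \<delta>" if "norm (M *v (y - ?y0)) \<le> R" for y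
  proof -
    have "dist y ?y0 \<le> B * norm (M *v (y - ?y0))"
      using NB by (simp add: dist_norm)
    also have "\<dots> \<le> B * R"
      using that B(1) by simp
    also have "\<dots> < \<delta>"
      using \<delta> B(1) by (simp add: R_def)
    finally show ?thesis .
  qed
  show ?thesis
  proof (rule that)
    show "0 < R"
      using \<delta> B(1) by (simp add: R_def)
    show "y \<in> ?W" if "norm (M *v (y - ?y0)) \<le> R" for y
      using near dist that by blast
    show "\<bar>chart_density g c y - \<bar>det M\<bar>\<bar> \<le> \<epsilon> * \<bar>det M\<bar>" if "norm (M *v (y - ?y0)) \<le> R" for y
      using near dist that by (force simp: dist_real_def)
    show "(norm (M *v v))\<^sup>2 \<le> (1 + \<epsilon>)\<^sup>2 * (v \<bullet> (g c (chart_inv c y) *v v))"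
      if "norm (M *v (y - ?y0)) \<le> R" for y v
    proof -
      let ?D = "\<gamma> ?y0 - \<gamma> y"
      have "\<bar>?D $ i $ j\<bar> \<le> \<eta>" for i j
        using near[OF dist[OF that]] component_le_norm_cart[of "?D $ i" j] Finite_Cartesian_Product.norm_nth_le[of ?D i]
        by (simp add: dist_norm norm_minus_commute)
      then have "onorm ((*v) ?D) \<le> k * \<eta>"
        unfolding k_def by (rule onorm_le_matrix_component)
      then have "norm (?D *v v) \<le> k * \<eta> * norm v"
        using onorm[OF matrix_vector_mul_bounded_linear, of ?D v]
        by (meson mult_right_mono norm_ge_zero order_trans)
      then have "v \<bullet> (?D *v v) \<le> norm v * (k * \<eta> * norm v)"
        by (meson Cauchy_Schwarz_ineq2 abs_le_D1 mult_left_mono norm_ge_zero order_trans)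
      also have "\<dots> = k * \<eta> * (norm v)\<^sup>2"
        by (simp add: power2_eq_square)
      also have "\<dots> \<le> k * \<eta> * (B * norm (M *v v))\<^sup>2"
        using NB k \<eta>(1) by (intro mult_left_mono power_mono) auto
      also have "\<dots> = \<epsilon> / (1 + \<epsilon>) * (norm (M *v v))\<^sup>2"
        by (simp add: power_mult_distrib flip: \<eta>(2))
      finally have D: "v \<bullet> (?D *v v) \<le> \<epsilon> / (1 + \<epsilon>) * (norm (M *v v))\<^sup>2" .
      have "v \<bullet> (\<gamma> ?y0 *v v) = (M *v v) \<bullet> (M *v v)"
        by (simp add: \<gamma>_def inv M(2) dot_lmul_matrix flip: matrix_vector_mul_assoc)
           (metis dot_lmul_matrix inner_commute)
      then have "v \<bullet> (?D *v v) = (norm (M *v v))\<^sup>2 - v \<bullet> (\<gamma> y *v v)"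
        by (simp add: matrix_vector_mult_diff_rdistrib inner_diff_right power2_norm_eq_inner)
      with D have "(norm (M *v v))\<^sup>2 * (1 - \<epsilon> / (1 + \<epsilon>)) \<le> v \<bullet> (\<gamma> y *v v)"
        by (simp add: algebra_simps)
      also have "1 - \<epsilon> / (1 + \<epsilon>) = 1 / (1 + \<epsilon>)"
        using \<epsilon> by (simp add: field_simps)
      finally have "(norm (M *v v))\<^sup>2 \<le> (1 + \<epsilon>) * (v \<bullet> (\<gamma> y *v v))"
        using \<epsilon> by (simp add: field_simps)
      moreover have "(1 + \<epsilon>) * (v \<bullet> (\<gamma> y *v v)) \<le> (1 + \<epsilon>)\<^sup>2 * (v \<bullet> (\<gamma> y *v v))"
      proof (rule mult_right_mono)
        have "0 \<le> (1 + \<epsilon>) * (v \<bullet> (\<gamma> y *v v))"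
          using calculation by (rule order_trans[rotated]) simp
        then show "0 \<le> v \<bullet> (\<gamma> y *v v)"
          using \<epsilon> by (simp add: zero_le_mult_iff)
        show "1 + \<epsilon> \<le> (1 + \<epsilon>)\<^sup>2"
          using \<epsilon> by (simp add: power2_eq_square)
      qed
      ultimately show ?thesis
        by (simp add: \<gamma>_def)
    qed
  qed
qed

section \<open>Balls that are almost Euclidean\<close>

text \<open>
  A ball in \<open>\<Omega>\<close> described by a radius function \<open>\<rho>\<close> on the whole manifold. Everything that the capacity
  estimates use about the manifold is listed here: sublevel sets of \<open>\<rho>\<close>, volumes of shells, and
  gradients of functions of \<open>\<rho>\<close>. Such functions are written as \<open>\<phi> (\<rho>\<^sup>2)\<close>, because \<open>\<rho>\<^sup>2\<close> is smooth at the
  centre, whereas \<open>\<rho>\<close> is not.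
\<close>

locale almost_euclidean_ball =
  fixes A :: "('a::{second_countable_topology, t2_space}, 'n::finite) chart set"
    and g :: "('a, 'n) metric_coeffs" and \<Omega> :: "'a set"
    and \<epsilon> R :: real and \<rho> :: "'a \<Rightarrow> real"
  assumes manifold: "riemannian_manifold A g" and \<epsilon>: "0 < \<epsilon>" and R: "0 < R" and nonneg: "\<And>x. 0 \<le> \<rho> x"
    and compact_sublevel: "\<And>r. r \<le> R \<Longrightarrow> compact {x. \<rho> x \<le> r}"
    and sublevel_subset: "{x. \<rho> x \<le> R} \<subseteq> \<Omega>"
    and shell_measurable: "\<And>s r. r \<le> R \<Longrightarrow> {x. s \<le> \<rho> x \<and> \<rho> x \<le> r} \<in> sets (riem_volume A g)"
    and shell_volume_le: "\<And>s r. 0 \<le> s \<Longrightarrow> s \<le> r \<Longrightarrow> r \<le> R \<Longrightarrow>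
      emeasure (riem_volume A g) {x. s \<le> \<rho> x \<and> \<rho> x \<le> r} \<le>
        ennreal ((1 + \<epsilon>) * measure lborel (ball (0 :: real ^ 'n) 1) * (r ^ CARD('n) - s ^ CARD('n)))"
    and shell_volume_ge: "\<And>s r. 0 \<le> s \<Longrightarrow> s \<le> r \<Longrightarrow> r \<le> R \<Longrightarrow>
      ennreal ((1 - \<epsilon>) * measure lborel (ball (0 :: real ^ 'n) 1) * (r ^ CARD('n) - s ^ CARD('n)))
        \<le> emeasure (riem_volume A g) {x. s \<le> \<rho> x \<and> \<rho> x \<le> r}"
    and radial_C01: "\<And>\<phi> \<phi>' r. \<lbrakk>0 < r; r \<le> R; \<And>t. (\<phi> has_real_derivative \<phi>' t) (at t);
        continuous_on UNIV \<phi>'; \<And>t. r\<^sup>2 \<le> t \<Longrightarrow> \<phi> t = 0\<rbrakk> \<Longrightarrow> (\<lambda>x. \<phi> ((\<rho> x)\<^sup>2)) \<in> C01 A \<Omega>"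
    and radial_gradient: "\<And>\<phi> \<phi>' r x. \<lbrakk>0 < r; r \<le> R; \<And>t. (\<phi> has_real_derivative \<phi>' t) (at t);
        continuous_on UNIV \<phi>'; \<And>t. r\<^sup>2 \<le> t \<Longrightarrow> \<phi> t = 0\<rbrakk> \<Longrightarrow>
        gradient_norm A g (\<lambda>x. \<phi> ((\<rho> x)\<^sup>2)) x \<le> 2 * (1 + \<epsilon>) * \<rho> x * \<bar>\<phi>' ((\<rho> x)\<^sup>2)\<bar>"

lemma has_derivative_radial:
  fixes M :: "real ^ 'n::finite ^ 'n"
  assumes "\<And>t. (\<phi> has_real_derivative \<phi>' t) (at t)"
  shows "((\<lambda>y. \<phi> ((norm (M *v (y - y0)))\<^sup>2)) has_derivative
    (\<lambda>h. 2 * \<phi>' ((norm (M *v (y - y0)))\<^sup>2) * ((M *v (y - y0)) \<bullet> (M *v h)))) (at y)"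
proof -
  have M: "((\<lambda>y. M *v (y - y0)) has_derivative (\<lambda>h. M *v h)) (at y)"
    by (auto intro!: derivative_eq_intros
        bounded_linear.has_derivative[OF matrix_vector_mul_bounded_linear])
  have "((\<lambda>y. (M *v (y - y0)) \<bullet> (M *v (y - y0))) has_derivative
      (\<lambda>h. 2 * ((M *v (y - y0)) \<bullet> (M *v h)))) (at y)"
    using has_derivative_inner[OF M M] by (simp add: inner_commute)
  then have "((\<lambda>y. (norm (M *v (y - y0)))\<^sup>2) has_derivative
      (\<lambda>h. 2 * ((M *v (y - y0)) \<bullet> (M *v h)))) (at y)"
    by (simp add: power2_norm_eq_inner)
  from DERIV_compose_FDERIV[OF assms this] show ?thesis
    by (simp add: mult_ac)
qed

lemma derivative_zero_beyond:
  fixes \<phi> :: "real \<Rightarrow> real"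
  assumes "(\<phi> has_real_derivative D) (at t)" "\<And>t. b \<le> t \<Longrightarrow> \<phi> t = 0" "b < t"
  shows "D = 0"
proof -
  have "((\<lambda>_. 0) has_real_derivative D) (at t)"
    by (rule has_field_derivative_transform_within_open[OF assms(1), of "{b<..}"])
       (use assms in auto)
  then show ?thesis
    using DERIV_unique DERIV_const by blast
qed

text \<open>
  In the coordinates \<open>M (c x - y0)\<close> the metric is the Euclidean one at the centre, and
  \<open>near_constant_metric\<close> controls it nearby. The gradient bound is duality: if \<open>v\<close> is the gradient and
  \<open>q\<close> its squared length, then \<open>q\<close> is the derivative of the function in direction \<open>v\<close>, and the
  Cauchy-Schwarz inequality for \<open>M\<close> bounds this by a multiple of \<open>\<bar>M v\<bar> \<le> (1 + \<epsilon>) sqrt q\<close>.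
\<close>

proposition almost_euclidean_ball_exists:
  fixes A :: "('a::{second_countable_topology, t2_space}, 'n::finite) chart set"
  assumes mfd: "riemannian_manifold A g" and \<Omega>: "open \<Omega>" "\<Omega> \<noteq> {}" and \<epsilon>: "0 < \<epsilon>"
  shows "\<exists>R \<rho>. almost_euclidean_ball A g \<Omega> \<epsilon> R \<rho>"
proof -
  let ?\<nu> = "measure lborel (ball (0 :: real ^ 'n) 1)"
  obtain x0 where x0: "x0 \<in> \<Omega>"
    using \<Omega> by blast
  obtain c where c: "c \<in> A" "x0 \<in> fst c"
    using atlas[OF mfd] unfolding smooth_atlas_def by blast
  obtain M :: "real ^ 'n ^ 'n" where M: "invertible M" "g c x0 = transpose M ** M"
    using positive_definite_factor metric_pd[OF mfd c] by blast
  obtain N where N: "M ** N = mat 1" "N ** M = mat 1"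
    using M(1) invertible_def by blast
  define y0 where "y0 = snd c x0"
  obtain R where R: "0 < R"
    and inside: "\<And>y. norm (M *v (y - y0)) \<le> R \<Longrightarrow> y \<in> snd c ` (fst c \<inter> \<Omega>)"
    and metric_ge: "\<And>y v. norm (M *v (y - y0)) \<le> R \<Longrightarrow>
      (norm (M *v v))\<^sup>2 \<le> (1 + \<epsilon>)\<^sup>2 * (v \<bullet> (g c (chart_inv c y) *v v))"
    and density: "\<And>y. norm (M *v (y - y0)) \<le> R \<Longrightarrow>
      \<bar>chart_density g c y - \<bar>det M\<bar>\<bar> \<le> \<epsilon> * \<bar>det M\<bar>"
    using near_constant_metric[OF mfd c x0 \<Omega>(1) \<epsilon> M] unfolding y0_def by blast
  have inv: "chart_inv c (snd c x) = x" if "x \<in> fst c" for x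
    using that chart_props(4)[OF atlas[OF mfd] c(1)] by simp
  \<comment> \<open>Outside the chart any value above \<open>R\<close> keeps the sublevel sets inside the chart and makes
    radial functions vanish there.\<close>
  define \<rho> where "\<rho> x = (if x \<in> fst c then norm (M *v (snd c x - y0)) else 2 * R)" for x
  define E where "E s r = {y. s \<le> norm (M *v (y - y0)) \<and> norm (M *v (y - y0)) \<le> r}" for s r
  have shell: "{x. s \<le> \<rho> x \<and> \<rho> x \<le> r} = chart_inv c ` E s r"
    and snd_shell: "snd c ` {x. s \<le> \<rho> x \<and> \<rho> x \<le> r} = E s r"
    and shell_sub: "{x. s \<le> \<rho> x \<and> \<rho> x \<le> r} \<subseteq> fst c \<inter> \<Omega>" if r: "r \<le> R" for s r
  proof -
    have E: "y \<in> snd c ` (fst c \<inter> \<Omega>)" if "y \<in> E s r" for y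
      using that inside r by (simp add: E_def)
    have *: "x \<in> fst c \<and> snd c x \<in> E s r" if "s \<le> \<rho> x" "\<rho> x \<le> r" for x
      using that r R by (auto simp: \<rho>_def E_def split: if_splits)
    have **: "\<rho> (chart_inv c y) = norm (M *v (y - y0))" "snd c (chart_inv c y) = y"
      if "y \<in> E s r" for y
      using E[OF that] inv by (auto simp: \<rho>_def)
    show "{x. s \<le> \<rho> x \<and> \<rho> x \<le> r} = chart_inv c ` E s r"
    proof (intro equalityI subsetI)
      fix x assume "x \<in> {x. s \<le> \<rho> x \<and> \<rho> x \<le> r}"
      with * have "x \<in> fst c" "snd c x \<in> E s r"
        by auto
      then show "x \<in> chart_inv c ` E s r"
        using inv by (metis imageI)
    qed (use ** in \<open>auto simp: E_def\<close>)
    then show "snd c ` {x. s \<le> \<rho> x \<and> \<rho> x \<le> r} = E s r"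
      using **(2) by (simp add: image_image)
    show "{x. s \<le> \<rho> x \<and> \<rho> x \<le> r} \<subseteq> fst c \<inter> \<Omega>"
    proof
      fix x assume "x \<in> {x. s \<le> \<rho> x \<and> \<rho> x \<le> r}"
      with * have x: "x \<in> fst c" "snd c x \<in> E s r"
        by auto
      from E[OF x(2)] obtain x' where x': "x' \<in> fst c" "x' \<in> \<Omega>" "snd c x = snd c x'"
        by blast
      have "x = x'"
        by (rule inj_onD[OF chart_props(4)[OF atlas[OF mfd] c(1)] x'(3) x(1) x'(1)])
      then show "x \<in> fst c \<inter> \<Omega>"
        using x' by (simp only: Int_iff)
    qed
  qed
  have compact_E: "compact (E s r)" for s r
  proof -
    have "E s r \<subseteq> (\<lambda>z. N *v z + y0) ` cball 0 r"
    proof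
      fix y assume "y \<in> E s r"
      then have "M *v (y - y0) \<in> cball 0 r"
        by (simp add: E_def)
      moreover have "N *v (M *v (y - y0)) + y0 = y"
        using N(2) by (simp add: matrix_vector_mul_assoc)
      ultimately show "y \<in> (\<lambda>z. N *v z + y0) ` cball 0 r"
        by (metis image_eqI)
    qed
    moreover have "bounded ((\<lambda>z. N *v z + y0) ` cball 0 r)"
      using continuous_on_matrix_diff[OF continuous_on_id, of _ N 0]
      by (intro compact_imp_bounded compact_continuous_image continuous_intros) auto
    moreover have "closed (E s r)"
      unfolding E_def by (intro closed_Collect_conj closed_Collect_le continuous_intros)
    ultimately show ?thesis
      using bounded_subset compact_eq_bounded_closed by blast
  qed
  have compact_shell: "compact {x. s \<le> \<rho> x \<and> \<rho> x \<le> r}" if "r \<le> R" for s r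
    unfolding shell[OF that]
  proof (rule compact_continuous_image[OF _ compact_E])
    have "E s r \<subseteq> snd c ` fst c"
      using snd_shell[OF that, of s] shell_sub[OF that, of s] by blast
    then show "continuous_on (E s r) (chart_inv c)"
      using chart_props(3)[OF atlas[OF mfd] c(1)] by (meson continuous_on_subset homeomorphism_cont2)
  qed
  have shell_borel: "{x. s \<le> \<rho> x \<and> \<rho> x \<le> r} \<in> sets borel" if "r \<le> R" for s r
    by (rule borel_closed[OF compact_imp_closed[OF compact_shell[OF that]]])
  have volume: "emeasure (riem_volume A g) {x. s \<le> \<rho> x \<and> \<rho> x \<le> r}
      = (\<integral>\<^sup>+y\<in>E s r. ennreal (chart_density g c y) \<partial>lborel)" if "r \<le> R" for s r
  proof -
    have "{x. s \<le> \<rho> x \<and> \<rho> x \<le> r} \<subseteq> fst c"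
      using shell_sub[OF that] by (rule order_trans) simp
    from emeasure_riem_volume[OF mfd c(1) shell_borel[OF that] this] show ?thesis
      by (simp only: chart_volume_def snd_shell[OF that])
  qed
  have E_sets: "E s r \<in> sets lborel" for s r
    unfolding sets_lborel by (rule borel_closed[OF compact_imp_closed[OF compact_E]])
  have E_volume: "(\<integral>\<^sup>+y\<in>E s r. ennreal (k * \<bar>det M\<bar>) \<partial>lborel)
      = ennreal (k * ?\<nu> * (r ^ CARD('n) - s ^ CARD('n)))"
    if "0 \<le> s" "s \<le> r" "0 \<le> k" for s r k
  proof -
    have "(\<integral>\<^sup>+y\<in>E s r. ennreal (k * \<bar>det M\<bar>) \<partial>lborel) = ennreal k * (ennreal \<bar>det M\<bar> * emeasure lborel (E s r))"
      unfolding nn_integral_cmult_indicator[OF E_sets] using that(3)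
      by (simp add: ennreal_mult mult.assoc)
    also have "\<dots> = ennreal k * ennreal (?\<nu> * (r ^ CARD('n) - s ^ CARD('n)))"
      by (simp only: E_def emeasure_ellipsoidal_shell[OF M(1) that(1,2)])
    finally show ?thesis
      using that by (simp add: ennreal_mult mult.assoc power_mono)
  qed
  define F where "F \<phi> y = \<phi> ((norm (M *v (y - y0)))\<^sup>2)" for \<phi> :: "real \<Rightarrow> real" and y
  define F' where "F' \<phi>' y h = 2 * \<phi>' ((norm (M *v (y - y0)))\<^sup>2) * ((M *v (y - y0)) \<bullet> (M *v h))"
    for \<phi>' :: "real \<Rightarrow> real" and y h
  have radial: "chart_function A g c (F \<phi>) (F' \<phi>') (E 0 r) (\<lambda>x. \<phi> ((\<rho> x)\<^sup>2))"
    if r: "0 < r" "r \<le> R" and \<phi>: "\<And>t. (\<phi> has_real_derivative \<phi>' t) (at t)"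
      "continuous_on UNIV \<phi>'" "\<And>t. r\<^sup>2 \<le> t \<Longrightarrow> \<phi> t = 0" for \<phi> \<phi>' r
  proof
    show "riemannian_manifold A g" "c \<in> A" "compact (E 0 r)"
      using mfd c(1) compact_E by auto
    show "(F \<phi> has_derivative F' \<phi>' y) (at y)" for y
      unfolding F_def[abs_def] F'_def[abs_def] by (rule has_derivative_radial[OF \<phi>(1)])
    show "continuous_on UNIV (\<lambda>y. F' \<phi>' y (axis i 1))" for i
    proof -
      have "continuous_on UNIV (\<lambda>y. \<phi>' ((norm (M *v (y - y0)))\<^sup>2))"
        by (rule continuous_on_compose2[OF \<phi>(2)]) (auto intro!: continuous_intros)
      then show ?thesis
        unfolding F'_def by (intro continuous_intros)
    qed
    show "E 0 r \<subseteq> snd c ` fst c"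
      using snd_shell[OF r(2), of 0] shell_sub[OF r(2), of 0] by blast
    show "F \<phi> y = 0" if "y \<notin> E 0 r" for y
      using that \<phi>(3) r by (auto simp: F_def E_def not_le intro!: power_mono)
    have "r\<^sup>2 \<le> (2 * R)\<^sup>2"
      using r by (intro power_mono) auto
    then show "\<phi> ((\<rho> x)\<^sup>2) = (if x \<in> fst c then F \<phi> (snd c x) else 0)" for x
      using \<phi>(3) by (simp add: \<rho>_def F_def)
  qed
  have "almost_euclidean_ball A g \<Omega> \<epsilon> R \<rho>"
  proof
    show "riemannian_manifold A g" "0 < \<epsilon>" "0 < R" by fact+
    show nonneg: "0 \<le> \<rho> x" for x
      using R by (simp add: \<rho>_def)
    show "compact {x. \<rho> x \<le> r}" if "r \<le> R" for r
      using compact_shell[OF that, of 0] nonneg by simp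
    show "{x. \<rho> x \<le> R} \<subseteq> \<Omega>"
      using shell_sub[of R 0] nonneg by auto
    show "{x. s \<le> \<rho> x \<and> \<rho> x \<le> r} \<in> sets (riem_volume A g)" if "r \<le> R" for s r
      using shell_borel[OF that] sets_riem_volume[OF mfd] by simp
  next
    fix s r :: real
    assume sr: "0 \<le> s" "s \<le> r" "r \<le> R"
    have dens: "(1 - \<epsilon>) * \<bar>det M\<bar> \<le> chart_density g c y" "chart_density g c y \<le> (1 + \<epsilon>) * \<bar>det M\<bar>"
      if "y \<in> E s r" for y
      using density[of y] that sr(3) by (auto simp: E_def abs_le_iff algebra_simps)
    show "emeasure (riem_volume A g) {x. s \<le> \<rho> x \<and> \<rho> x \<le> r}
        \<le> ennreal ((1 + \<epsilon>) * ?\<nu> * (r ^ CARD('n) - s ^ CARD('n)))"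
      unfolding volume[OF sr(3)]
        E_volume[OF sr(1,2) add_nonneg_nonneg[OF zero_le_one less_imp_le[OF \<epsilon>]], symmetric]
      using dens by (intro nn_integral_mono) (auto simp: indicator_def ennreal_leI)
    show "ennreal ((1 - \<epsilon>) * ?\<nu> * (r ^ CARD('n) - s ^ CARD('n)))
        \<le> emeasure (riem_volume A g) {x. s \<le> \<rho> x \<and> \<rho> x \<le> r}"
    proof (cases "0 \<le> 1 - \<epsilon>")
      case True
      show ?thesis
        unfolding volume[OF sr(3)] E_volume[OF sr(1,2) True, symmetric]
        using dens by (intro nn_integral_mono) (auto simp: indicator_def ennreal_leI)
    next
      case False
      then have "(1 - \<epsilon>) * ?\<nu> * (r ^ CARD('n) - s ^ CARD('n)) \<le> 0"
        using sr by (intro mult_nonpos_nonneg) (auto simp: power_mono)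
      then show ?thesis
        by (simp add: ennreal_neg)
    qed
  next
    fix \<phi> \<phi>' :: "real \<Rightarrow> real" and r
    assume r: "0 < r" "r \<le> R" and \<phi>: "\<And>t. (\<phi> has_real_derivative \<phi>' t) (at t)"
      "continuous_on UNIV \<phi>'" "\<And>t. r\<^sup>2 \<le> t \<Longrightarrow> \<phi> t = 0"
    have rad: "chart_function A g c (F \<phi>) (F' \<phi>') (E 0 r) (\<lambda>x. \<phi> ((\<rho> x)\<^sup>2))"
      by (rule radial[OF r \<phi>])
    have "E 0 r \<subseteq> snd c ` (fst c \<inter> \<Omega>)"
      using snd_shell[OF r(2), of 0] shell_sub[OF r(2), of 0] by blast
    then show "(\<lambda>x. \<phi> ((\<rho> x)\<^sup>2)) \<in> C01 A \<Omega>"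
      by (rule chart_function.in_C01[OF rad])
    fix x
    show "gradient_norm A g (\<lambda>x. \<phi> ((\<rho> x)\<^sup>2)) x \<le> 2 * (1 + \<epsilon>) * \<rho> x * \<bar>\<phi>' ((\<rho> x)\<^sup>2)\<bar>"
    proof (cases "x \<in> fst c")
      case False
      then show ?thesis
        using chart_function.gradient_norm_outside[OF rad] R \<epsilon> by (simp add: \<rho>_def)
    next
      case True
      let ?z = "M *v (snd c x - y0)"
      have \<rho>: "\<rho> x = norm ?z"
        using True by (simp add: \<rho>_def)
      obtain v where v: "g c x *v v = (\<chi> i. F' \<phi>' (snd c x) (axis i 1))"
        and grad: "gradient_norm A g (\<lambda>x. \<phi> ((\<rho> x)\<^sup>2)) x = sqrt (v \<bullet> (g c x *v v))"
        using chart_function.gradient_norm_inside[OF rad True] by blast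
      define q where "q = v \<bullet> (g c x *v v)"
      have q0: "0 \<le> q"
        using metric_pd(2)[OF mfd c(1) True, of v] by (cases "v = 0") (auto simp: q_def)
      have "(\<chi> i. F' \<phi>' (snd c x) (axis i 1)) = (2 * \<phi>' ((\<rho> x)\<^sup>2)) *\<^sub>R (transpose M *v ?z)"
        by (simp add: vec_eq_iff F'_def \<rho> inner_axis flip: dot_lmul_matrix)
      then have q: "q = 2 * \<phi>' ((\<rho> x)\<^sup>2) * (?z \<bullet> (M *v v))"
        by (simp add: q_def v inner_commute[of v] dot_lmul_matrix)
      show ?thesis
      proof (cases "\<rho> x \<le> r")
        case False
        then have "\<phi>' ((\<rho> x)\<^sup>2) = 0"
          using r by (intro derivative_zero_beyond[OF \<phi>(1,3)]) (auto intro: power_strict_mono)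
        then show ?thesis
          using q by (simp add: grad flip: q_def)
      next
        case le: True
        have "(norm (M *v v))\<^sup>2 \<le> (1 + \<epsilon>)\<^sup>2 * q"
          using metric_ge[of "snd c x" v] le r(2) inv[OF True] by (simp add: \<rho> q_def)
        then have "norm (M *v v) \<le> (1 + \<epsilon>) * sqrt q"
          using real_le_rsqrt[OF \<open>(norm (M *v v))\<^sup>2 \<le> (1 + \<epsilon>)\<^sup>2 * q\<close>] \<epsilon>
          by (simp add: real_sqrt_mult)
        then have "\<bar>?z \<bullet> (M *v v)\<bar> \<le> \<rho> x * ((1 + \<epsilon>) * sqrt q)"
          unfolding \<rho> by (meson Cauchy_Schwarz_ineq2 mult_left_mono norm_ge_zero order_trans)
        then have "2 * \<bar>\<phi>' ((\<rho> x)\<^sup>2)\<bar> * \<bar>?z \<bullet> (M *v v)\<bar>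
            \<le> 2 * \<bar>\<phi>' ((\<rho> x)\<^sup>2)\<bar> * (\<rho> x * ((1 + \<epsilon>) * sqrt q))"
          by (intro mult_left_mono) auto
        moreover have "q \<le> 2 * \<bar>\<phi>' ((\<rho> x)\<^sup>2)\<bar> * \<bar>?z \<bullet> (M *v v)\<bar>"
          unfolding q by (rule order_trans[OF abs_ge_self]) (simp add: abs_mult)
        ultimately have "q \<le> 2 * \<bar>\<phi>' ((\<rho> x)\<^sup>2)\<bar> * (\<rho> x * ((1 + \<epsilon>) * sqrt q))"
          by linarith
        then have "sqrt q * sqrt q \<le> (2 * (1 + \<epsilon>) * \<rho> x * \<bar>\<phi>' ((\<rho> x)\<^sup>2)\<bar>) * sqrt q"
          using q0 by (simp add: algebra_simps)
        then have "sqrt q \<le> 2 * (1 + \<epsilon>) * \<rho> x * \<bar>\<phi>' ((\<rho> x)\<^sup>2)\<bar>"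
        proof (cases "q = 0")
          case True
          then show ?thesis
            using \<epsilon> by (simp add: \<rho>)
        next
          case False
          then have "0 < sqrt q"
            using q0 by simp
          then show ?thesis
            by (rule mult_right_le_imp_le[rotated]) fact
        qed
        then show ?thesis
          by (simp add: grad flip: q_def)
      qed
    qed
  qed
  then show ?thesis
    by blast
qed

section \<open>Capacity bounds from layered cutoffs\<close>

text \<open>
  Half of \<open>t\<^sup>2 + t \<bar>t\<bar>\<close> is the square of the positive part, which makes it a \<open>C\<^sup>1\<close> building block for
  cutoffs.
\<close>

lemma DERIV_times_abs: "((\<lambda>t. t * \<bar>t\<bar>) has_real_derivative 2 * \<bar>t\<bar>) (at t)" for t :: real
proof -
  consider "t = 0" | "t < 0" | "t > 0"
    by linarith
  then show ?thesis
  proof cases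
    case 1
    have "((\<lambda>h::real. \<bar>h\<bar>) \<longlongrightarrow> 0) (at 0)"
      by (auto intro!: tendsto_eq_intros)
    then have "((\<lambda>h::real. (h * \<bar>h\<bar> - 0 * \<bar>0\<bar>) / (h - 0)) \<longlongrightarrow> 0) (at 0)"
      by (rule Lim_transform_eventually) (simp add: eventually_at_filter)
    then show ?thesis
      using 1 by (simp add: has_field_derivative_iff)
  next
    case 2
    have "((\<lambda>t::real. - (t * t)) has_real_derivative 2 * \<bar>t\<bar>) (at t)"
      using 2 by (auto intro!: derivative_eq_intros)
    then show ?thesis
      by (rule has_field_derivative_transform_within_open[of _ _ _ "{..<0}"]) (use 2 in auto)
  next
    case 3
    have "((\<lambda>t::real. t * t) has_real_derivative 2 * \<bar>t\<bar>) (at t)"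
      using 3 by (auto intro!: derivative_eq_intros)
    then show ?thesis
      by (rule has_field_derivative_transform_within_open[of _ _ _ "{0<..}"]) (use 3 in auto)
  qed
qed

text \<open>
  A \<open>C\<^sup>1\<close> step from \<open>0\<close> to \<open>1\<close> on the unit interval whose slope exceeds the unavoidable \<open>1\<close> by at most
  \<open>\<delta>\<close>; the sharp constant of the critical case requires \<open>\<delta>\<close> to be arbitrarily small. The derivative is a
  trapezoid, that is, a combination of four shifted positive parts.
\<close>

lemma steep_cutoff:
  fixes \<delta> :: real
  assumes \<delta>: "0 < \<delta>"
  obtains W W' :: "real \<Rightarrow> real"
  where "\<And>t. (W has_real_derivative W' t) (at t)" "continuous_on UNIV W'"
    "\<And>t. t \<le> 0 \<Longrightarrow> W t = 0" "\<And>t. 1 \<le> t \<Longrightarrow> W t = 1" "\<And>t. 0 \<le> W t"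
    "\<And>t. 0 \<le> W' t" "\<And>t. W' t \<le> 1 + \<delta>" "\<And>t. t \<le> 0 \<or> 1 \<le> t \<Longrightarrow> W' t = 0"
proof -
  define m where "m t = (t\<^sup>2 + t * \<bar>t\<bar>) / 4" for t :: real
  have m: "(m has_real_derivative max 0 t) (at t)" for t
  proof -
    have "((\<lambda>t. t\<^sup>2) has_real_derivative 2 * t) (at t)"
      by (auto intro!: derivative_eq_intros)
    then have "(m has_real_derivative (2 * t + 2 * \<bar>t\<bar>) / 4) (at t)"
      unfolding m_def by (intro DERIV_cdivide DERIV_add DERIV_times_abs)
    then show ?thesis
      by (simp add: max_def abs_if split: if_splits)
  qed
  have m_neg: "m t = 0" if "t \<le> 0" for t
    using that by (simp add: m_def power2_eq_square)
  have m_pos: "m t = t\<^sup>2 / 2" if "0 \<le> t" for t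
    using that by (simp add: m_def power2_eq_square)
  define W where "W t = (m ((1 + \<delta>) * t - 0) - m ((1 + \<delta>) * t - \<delta>) - m ((1 + \<delta>) * t - 1)
    + m ((1 + \<delta>) * t - (1 + \<delta>))) / \<delta>" for t
  define V where "V s = max 0 s - max 0 (s - \<delta>) - max 0 (s - 1) + max 0 (s - (1 + \<delta>))" for s
  define W' where "W' t = (1 + \<delta>) / \<delta> * V ((1 + \<delta>) * t)" for t
  have W: "(W has_real_derivative W' t) (at t)" for t
  proof -
    have m_affine: "((\<lambda>t. m ((1 + \<delta>) * t - a)) has_real_derivative
        max 0 ((1 + \<delta>) * t - a) * (1 + \<delta>)) (at t)" for a
      by (rule DERIV_chain2[OF m]) (auto intro!: derivative_eq_intros)
    have "(W has_real_derivative (max 0 ((1 + \<delta>) * t - 0) * (1 + \<delta>)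
        - max 0 ((1 + \<delta>) * t - \<delta>) * (1 + \<delta>) - max 0 ((1 + \<delta>) * t - 1) * (1 + \<delta>)
        + max 0 ((1 + \<delta>) * t - (1 + \<delta>)) * (1 + \<delta>)) / \<delta>) (at t)"
      unfolding W_def by (intro DERIV_cdivide DERIV_add DERIV_diff m_affine)
    also have "(max 0 ((1 + \<delta>) * t - 0) * (1 + \<delta>)
        - max 0 ((1 + \<delta>) * t - \<delta>) * (1 + \<delta>) - max 0 ((1 + \<delta>) * t - 1) * (1 + \<delta>)
        + max 0 ((1 + \<delta>) * t - (1 + \<delta>)) * (1 + \<delta>)) / \<delta> = W' t"
    proof -
      have "(a * k - b * k - c * k + d * k) / \<delta> = k / \<delta> * (a - b - c + d)" for a b c d k :: real
        by (simp add: algebra_simps diff_divide_distrib add_divide_distrib)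
      then show ?thesis
        by (simp only: W'_def V_def diff_zero)
    qed
    finally show ?thesis .
  qed
  have cont: "continuous_on UNIV W'"
    unfolding W'_def V_def by (intro continuous_intros)
  have V: "0 \<le> V s" "V s \<le> \<delta>" for s
    using \<delta> by (auto simp: V_def max_def)
  have V0: "V s = 0" if "s \<le> 0 \<or> 1 + \<delta> \<le> s" for s
    using \<delta> that by (auto simp: V_def max_def)
  have W0: "W t = 0" if "t \<le> 0" for t
  proof -
    have "(1 + \<delta>) * t \<le> 0"
      using \<delta> that by (simp add: mult_nonneg_nonpos)
    then have "m ((1 + \<delta>) * t - a) = 0" if "0 \<le> a" for a
      using that by (intro m_neg) linarith
    then show ?thesis
      using \<delta> by (simp only: W_def) simp
  qed
  have W'_nonneg: "0 \<le> W' t" for t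
    using V \<delta> by (simp add: W'_def)
  show ?thesis
  proof (rule that[OF W cont W0])
    show "W t = 1" if "1 \<le> t" for t
    proof -
      have "1 + \<delta> \<le> (1 + \<delta>) * t"
        using \<delta> that by simp
      then have m: "m ((1 + \<delta>) * t - a) = ((1 + \<delta>) * t - a)\<^sup>2 / 2" if "a \<le> 1 + \<delta>" for a
        using that by (intro m_pos) linarith
      have "(s - 0)\<^sup>2 / 2 - (s - \<delta>)\<^sup>2 / 2 - (s - 1)\<^sup>2 / 2 + (s - (1 + \<delta>))\<^sup>2 / 2 = \<delta>" for s
        by (simp add: power2_eq_square field_simps)
      then show ?thesis
        using \<delta> by (simp only: W_def m) simp
    qed
    show "0 \<le> W t" for t
    proof (cases "t \<le> 0")
      case False
      then have "W 0 \<le> W t"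
        using W W'_nonneg by (intro DERIV_nonneg_imp_nondecreasing[of 0 t W]) auto
      then show ?thesis
        by (simp add: W0)
    qed (simp add: W0)
    show "W' t \<le> 1 + \<delta>" for t
    proof -
      have "(1 + \<delta>) / \<delta> * V ((1 + \<delta>) * t) \<le> (1 + \<delta>) / \<delta> * \<delta>"
        using V \<delta> by (intro mult_left_mono) auto
      then show ?thesis
        using \<delta> by (simp add: W'_def)
    qed
    show "W' t = 0" if "t \<le> 0 \<or> 1 \<le> t" for t
    proof -
      have "(1 + \<delta>) * t \<le> 0 \<or> 1 + \<delta> \<le> (1 + \<delta>) * t"
        using \<delta> that by (auto simp: mult_nonneg_nonpos)
      then show ?thesis
        using V0 by (simp add: W'_def)
    qed
  qed (use W'_nonneg in auto)
qed

context almost_euclidean_ball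
begin

text \<open>
  The average of \<open>N\<close> cutoffs that live on consecutive shells with ratio \<open>b\<close>. The slope of the \<open>k\<close>-th
  cutoff in the variable \<open>\<rho>\<^sup>2\<close> is about \<open>1 / (D\<^sup>2 (1 - b\<^sup>2))\<close> with \<open>D = b\<^sup>k r\<close> its outer radius. The
  conclusion names the one shell on which the gradient can be nonzero at a given point, because
  this is what makes the \<open>p\<close>-energies additive.
\<close>

lemma layered_test_function:
  fixes b r \<delta> :: real and N :: nat
  assumes b: "0 < b" "b < 1" and r: "0 < r" "r \<le> R" and \<delta>: "0 < \<delta>" and N: "0 < N"
  defines "m \<equiv> 2 * (1 + \<epsilon>) * (1 + \<delta>) / (real N * (1 - b\<^sup>2))"
  obtains f where "f \<in> C01 A \<Omega>" "\<And>x. 0 \<le> f x" "\<And>x. \<rho> x \<le> b ^ N * r \<Longrightarrow> f x = 1"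
    and "\<And>x. gradient_norm A g f x = 0 \<or> (\<exists>k<N. b * (b ^ k * r) \<le> \<rho> x \<and> \<rho> x \<le> b ^ k * r \<and>
      gradient_norm A g f x \<le> m / (b ^ k * r))"
proof -
  obtain W W' :: "real \<Rightarrow> real" where W: "\<And>t. (W has_real_derivative W' t) (at t)"
    "continuous_on UNIV W'" "\<And>t. t \<le> 0 \<Longrightarrow> W t = 0" "\<And>t. 1 \<le> t \<Longrightarrow> W t = 1" "\<And>t. 0 \<le> W t"
    "\<And>t. 0 \<le> W' t" "\<And>t. W' t \<le> 1 + \<delta>" "\<And>t. t \<le> 0 \<or> 1 \<le> t \<Longrightarrow> W' t = 0"
    using steep_cutoff[OF \<delta>] by blast
  define D where "D k = b ^ k * r" for k :: nat
  have D: "0 < D k" "D k \<le> r" for k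
    using b r by (auto simp: D_def mult_le_cancel_right2 power_le_one)
  have D_mono: "D j \<le> b * D k" if "k < j" for j k
  proof -
    have "b ^ j \<le> b ^ Suc k"
      using that b by (intro power_decreasing) auto
    then show ?thesis
      using r by (simp add: D_def)
  qed
  have b2: "0 < 1 - b\<^sup>2"
    using b by (simp add: power_less_one_iff abs_square_less_1)
  define u where "u k t = (1 - t / (D k)\<^sup>2) / (1 - b\<^sup>2)" for k t
  have u0: "u k t \<le> 0" if "(D k)\<^sup>2 \<le> t" for k t
    using that b2 D(1)[of k] by (simp add: u_def divide_nonpos_pos)
  have u1: "1 \<le> u k t" if "t \<le> (b * D k)\<^sup>2" for k t
    using that b2 D(1)[of k] by (simp add: u_def power_mult_distrib field_simps)
  define \<phi> where "\<phi> t = (\<Sum>k<N. W (u k t)) / real N" for t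
  define \<phi>' where "\<phi>' t = (\<Sum>k<N. W' (u k t) * (- 1 / ((D k)\<^sup>2 * (1 - b\<^sup>2)))) / real N" for t
  have u_deriv: "(u k has_real_derivative - 1 / ((D k)\<^sup>2 * (1 - b\<^sup>2))) (at t)" for k t
  proof -
    have "(u k has_real_derivative (0 - 1 / (D k)\<^sup>2) / (1 - b\<^sup>2)) (at t)"
      unfolding u_def by (intro DERIV_cdivide DERIV_diff DERIV_const DERIV_ident)
    then show ?thesis
      by simp
  qed
  have \<phi>: "(\<phi> has_real_derivative \<phi>' t) (at t)" for t
    unfolding \<phi>_def \<phi>'_def using N
    by (intro DERIV_cdivide DERIV_sum DERIV_chain2[OF W(1) u_deriv])
  have "continuous_on UNIV (\<lambda>t. W' (u k t))" for k
  proof -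
    have "continuous_on UNIV (u k)"
      using DERIV_isCont[OF u_deriv] by (simp add: continuous_at_imp_continuous_on)
    then show ?thesis
      by (rule continuous_on_compose2[OF W(2)]) simp
  qed
  then have cont: "continuous_on UNIV \<phi>'"
    unfolding \<phi>'_def using N by (intro continuous_intros) auto
  have zero: "\<phi> t = 0" if "r\<^sup>2 \<le> t" for t
  proof -
    have "(D k)\<^sup>2 \<le> t" for k
      using D[of k] that by (meson order_trans power_mono less_imp_le)
    then show ?thesis
      using u0 W(3) by (simp add: \<phi>_def)
  qed
  show ?thesis
  proof (rule that)
    show "(\<lambda>x. \<phi> ((\<rho> x)\<^sup>2)) \<in> C01 A \<Omega>"
      by (rule radial_C01[OF r \<phi> cont zero])
    show "0 \<le> \<phi> ((\<rho> x)\<^sup>2)" for x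
      unfolding \<phi>_def by (intro divide_nonneg_nonneg sum_nonneg W(5)) simp
    show "\<phi> ((\<rho> x)\<^sup>2) = 1" if "\<rho> x \<le> b ^ N * r" for x
    proof -
      have "(\<rho> x)\<^sup>2 \<le> (b * D k)\<^sup>2" if "k < N" for k
        using D_mono[OF that] \<open>\<rho> x \<le> b ^ N * r\<close> nonneg by (intro power_mono) (auto simp: D_def)
      then show ?thesis
        using u1 W(4) N by (simp add: \<phi>_def)
    qed
    show "gradient_norm A g (\<lambda>x. \<phi> ((\<rho> x)\<^sup>2)) x = 0 \<or>
        (\<exists>k<N. b * (b ^ k * r) \<le> \<rho> x \<and> \<rho> x \<le> b ^ k * r \<and>
          gradient_norm A g (\<lambda>x. \<phi> ((\<rho> x)\<^sup>2)) x \<le> m / (b ^ k * r))" for x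
    proof -
      let ?t = "(\<rho> x)\<^sup>2"
      have grad: "gradient_norm A g (\<lambda>x. \<phi> ((\<rho> x)\<^sup>2)) x \<le> 2 * (1 + \<epsilon>) * \<rho> x * \<bar>\<phi>' ?t\<bar>"
        by (rule radial_gradient[OF r \<phi> cont zero])
      have W'0: "W' (u j ?t) = 0" if "D j \<le> \<rho> x \<or> \<rho> x \<le> b * D j" for j
        using that u0[of j ?t] u1[of ?t j] W(8)[of "u j ?t"] D(1)[of j] nonneg[of x]
        by (metis less_imp_le power_mono)
      show ?thesis
      proof (cases "\<exists>k<N. b * D k < \<rho> x \<and> \<rho> x < D k")
        case True
        then obtain k where k: "k < N" "b * D k < \<rho> x" "\<rho> x < D k"
          by blast
        \<comment> \<open>Shells further out have their inner radius, and shells further in their outer radius, on the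
          wrong side of \<open>\<rho> x\<close>.\<close>
        have "W' (u j ?t) = 0" if "j \<noteq> k" for j
          using D_mono[of j k] D_mono[of k j] that k by (intro W'0) (cases j k rule: linorder_cases; simp)
        then have "\<phi>' ?t = W' (u k ?t) * (- 1 / ((D k)\<^sup>2 * (1 - b\<^sup>2))) / real N"
          unfolding \<phi>'_def using k(1) by (subst sum.remove[of _ k]) auto
        then have "\<bar>\<phi>' ?t\<bar> = W' (u k ?t) / ((D k)\<^sup>2 * (1 - b\<^sup>2) * real N)"
          using W(6)[of "u k ?t"] b2 by (simp add: abs_mult)
        also have "\<dots> \<le> (1 + \<delta>) / ((D k)\<^sup>2 * (1 - b\<^sup>2) * real N)"
          using W(7) b2 by (intro divide_right_mono) auto
        finally have "2 * (1 + \<epsilon>) * \<rho> x * \<bar>\<phi>' ?t\<bar> \<le>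
            2 * (1 + \<epsilon>) * D k * ((1 + \<delta>) / ((D k)\<^sup>2 * (1 - b\<^sup>2) * real N))"
          using k(3) \<epsilon> nonneg[of x] D(1)[of k] by (intro mult_mono) auto
        also have "\<dots> = m / D k"
          using D(1)[of k] by (simp add: m_def power2_eq_square)
        finally show ?thesis
          using grad k unfolding D_def by (meson less_imp_le order_trans)
      next
        case False
        then have "\<phi>' ?t = 0"
          unfolding \<phi>'_def using W'0 by (intro divide_eq_0_iff[THEN iffD2] disjI1 sum.neutral) (metis (no_types) lessThan_iff linorder_not_less mult_zero_left)
        then show ?thesis
          using grad gradient_norm_nonneg[OF manifold, of "\<lambda>x. \<phi> ((\<rho> x)\<^sup>2)" x] by simp
      qed
    qed
  qed
qed

lemma p_capacity_le:
  fixes b r \<delta> p :: real and N :: nat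
  assumes b: "0 < b" "b < 1" and r: "0 < r" "r \<le> R" and \<delta>: "0 < \<delta>" and N: "0 < N" and p: "0 \<le> p"
    and K: "K \<subseteq> {x. \<rho> x \<le> b ^ N * r}"
  defines "m \<equiv> 2 * (1 + \<epsilon>) * (1 + \<delta>) / (real N * (1 - b\<^sup>2))"
  shows "p_capacity A g p K \<Omega> \<le> ennreal (\<Sum>k<N. (m / (b ^ k * r)) powr p *
    ((1 + \<epsilon>) * measure lborel (ball (0 :: real ^ 'n) 1) * ((b ^ k * r) ^ CARD('n) - (b * (b ^ k * r)) ^ CARD('n))))"
proof -
  obtain f where f: "f \<in> C01 A \<Omega>" "\<And>x. 0 \<le> f x" "\<And>x. \<rho> x \<le> b ^ N * r \<Longrightarrow> f x = 1"
    and grad: "\<And>x. gradient_norm A g f x = 0 \<or> (\<exists>k<N. b * (b ^ k * r) \<le> \<rho> x \<and> \<rho> x \<le> b ^ k * r \<and>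
      gradient_norm A g f x \<le> m / (b ^ k * r))"
    using layered_test_function[OF b r \<delta> N] unfolding m_def by blast
  define D where "D k = b ^ k * r" for k :: nat
  have D: "0 < D k" "D k \<le> r" "D k \<le> R" for k
    using b r by (auto simp: D_def mult_le_cancel_right2 power_le_one intro: order_trans[OF _ r(2)])
  define S where "S k = {x. b * D k \<le> \<rho> x \<and> \<rho> x \<le> D k}" for k
  have S: "S k \<in> sets (riem_volume A g)" for k
    unfolding S_def by (rule shell_measurable[OF D(3)])
  have "p_capacity A g p K \<Omega> \<le> (\<integral>\<^sup>+x\<in>\<Omega>. ennreal (gradient_norm A g f x powr p) \<partial>riem_volume A g)"
    unfolding p_capacity_def using f K by (intro INF_lower) (auto simp: indicator_def)
  also have "\<dots> \<le> (\<integral>\<^sup>+x. (\<Sum>k<N. ennreal ((m / D k) powr p) * indicator (S k) x) \<partial>riem_volume A g)"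
  proof (rule nn_integral_mono)
    fix x
    show "ennreal (gradient_norm A g f x powr p) * indicator \<Omega> x
        \<le> (\<Sum>k<N. ennreal ((m / D k) powr p) * indicator (S k) x)"
      using grad[of x]
    proof (elim disjE exE conjE)
      fix k assume k: "k < N" "b * (b ^ k * r) \<le> \<rho> x" "\<rho> x \<le> b ^ k * r"
        "gradient_norm A g f x \<le> m / (b ^ k * r)"
      have "ennreal (gradient_norm A g f x powr p) * indicator \<Omega> x \<le> ennreal (gradient_norm A g f x powr p)"
        by (simp add: indicator_def)
      also have "\<dots> \<le> ennreal ((m / D k) powr p)"
        using k(4) p gradient_norm_nonneg[OF manifold] by (intro ennreal_leI powr_mono2) (auto simp: D_def)
      also have "\<dots> = ennreal ((m / D k) powr p) * indicator (S k) x"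
        using k by (simp add: S_def D_def)
      also have "\<dots> \<le> (\<Sum>k<N. ennreal ((m / D k) powr p) * indicator (S k) x)"
        using k(1) by (intro member_le_sum) auto
      finally show ?thesis .
    qed simp
  qed
  also have "\<dots> = (\<Sum>k<N. ennreal ((m / D k) powr p) * emeasure (riem_volume A g) (S k))"
    using S by (subst nn_integral_sum) (auto intro!: sum.cong nn_integral_cmult_indicator)
  also have "\<dots> \<le> (\<Sum>k<N. ennreal ((m / D k) powr p) *
      ennreal ((1 + \<epsilon>) * measure lborel (ball (0 :: real ^ 'n) 1) * (D k ^ CARD('n) - (b * D k) ^ CARD('n))))"
    unfolding S_def using D(3) less_imp_le[OF D(1)] b
    by (intro sum_mono mult_left_mono shell_volume_le) (simp_all add: mult_left_le_one_le)
  also have "\<dots> = ennreal (\<Sum>k<N. (m / D k) powr p * ((1 + \<epsilon>) * measure lborel (ball (0 :: real ^ 'n) 1) * (D k ^ CARD('n) - (b * D k) ^ CARD('n))))"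
  proof -
    have "(b * D k) ^ CARD('n) \<le> D k ^ CARD('n)" for k
      using D(1)[of k] b by (intro power_mono) auto
    then have "0 \<le> (1 + \<epsilon>) * measure lborel (ball (0 :: real ^ 'n) 1) * (D k ^ CARD('n) - (b * D k) ^ CARD('n))" for k
      using \<epsilon> by simp
    then show ?thesis
      by (subst sum_ennreal[symmetric]) (auto intro!: sum.cong simp flip: ennreal_mult')
  qed
  finally show ?thesis
    by (simp add: D_def)
qed

text \<open>
  One layer with \<open>b = 1/2\<close> and \<open>\<delta> = 1\<close>: the slope bound \<open>2 (1 + \<epsilon>) (1 + 1) / (1 - 1/4)\<close> is below \<open>6 (1 + \<epsilon>)\<close>.
\<close>

lemma infty_capacity_le:
  assumes r: "0 < r" "r \<le> R" and K: "K \<subseteq> {x. \<rho> x \<le> r / 2}"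
  shows "infty_capacity A g K \<Omega> \<le> ennreal (6 * (1 + \<epsilon>) / r)"
proof -
  have half: "0 < (1/2 :: real)" "(1/2 :: real) < 1" "0 < (1 :: real)" "0 < (1 :: nat)"
    by auto
  obtain f where f: "f \<in> C01 A \<Omega>" "\<And>x. 0 \<le> f x" "\<And>x. \<rho> x \<le> (1/2) ^ 1 * r \<Longrightarrow> f x = 1"
    and grad: "\<And>x. gradient_norm A g f x = 0 \<or> (\<exists>k<1. 1/2 * ((1/2) ^ k * r) \<le> \<rho> x \<and> \<rho> x \<le> (1/2) ^ k * r \<and>
      gradient_norm A g f x \<le> 2 * (1 + \<epsilon>) * (1 + 1) / (real 1 * (1 - (1/2)\<^sup>2)) / ((1/2) ^ k * r))"
    using layered_test_function[OF half(1,2) r half(3,4)] by blast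
  have "gradient_norm A g f x \<le> 6 * (1 + \<epsilon>) / r" for x
    using grad[of x] \<epsilon> r by (auto simp: power2_eq_square divide_simps)
  moreover have "infty_capacity A g K \<Omega> \<le> (SUP x\<in>\<Omega>. ennreal (gradient_norm A g f x))"
    unfolding infty_capacity_def using f K by (intro INF_lower) (auto simp: indicator_def subset_eq)
  ultimately show ?thesis
    by (meson SUP_least ennreal_leI order_trans)
qed

lemma sublevel_volume:
  assumes s: "0 < s" "s \<le> R" and "\<epsilon> < 1"
  shows "{x. \<rho> x \<le> s} \<in> pos_compacts A g \<Omega>"
    and "(1 - \<epsilon>) * measure lborel (ball (0 :: real ^ 'n) 1) * s ^ CARD('n) \<le> measure (riem_volume A g) {x. \<rho> x \<le> s}"
    and "measure (riem_volume A g) {x. \<rho> x \<le> s} \<le> (1 + \<epsilon>) * measure lborel (ball (0 :: real ^ 'n) 1) * s ^ CARD('n)"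
    and "0 < measure lborel (ball (0 :: real ^ 'n) 1)" 
proof -
  show \<nu>: "0 < measure lborel (ball (0 :: real ^ 'n) 1)"
    by (simp add: content_ball)
  let ?e = "emeasure (riem_volume A g) {x. \<rho> x \<le> s}"
  have eq: "{x. 0 \<le> \<rho> x \<and> \<rho> x \<le> s} = {x. \<rho> x \<le> s}"
    using nonneg by auto
  have le: "?e \<le> ennreal ((1 + \<epsilon>) * measure lborel (ball (0 :: real ^ 'n) 1) * s ^ CARD('n))"
    using shell_volume_le[of 0 s] s by (simp add: eq zero_power)
  have ge: "ennreal ((1 - \<epsilon>) * measure lborel (ball (0 :: real ^ 'n) 1) * s ^ CARD('n)) \<le> ?e"
    using shell_volume_ge[of 0 s] s by (simp add: eq zero_power)
  have pos: "0 < (1 - \<epsilon>) * measure lborel (ball (0 :: real ^ 'n) 1) * s ^ CARD('n)"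
    using assms \<nu> by simp
  have fin: "?e = ennreal (measure (riem_volume A g) {x. \<rho> x \<le> s})"
    using le by (intro emeasure_eq_ennreal_measure) (auto simp: top_unique)
  show "(1 - \<epsilon>) * measure lborel (ball (0 :: real ^ 'n) 1) * s ^ CARD('n) \<le> measure (riem_volume A g) {x. \<rho> x \<le> s}"
    using ge unfolding fin by simp
  show "measure (riem_volume A g) {x. \<rho> x \<le> s} \<le> (1 + \<epsilon>) * measure lborel (ball (0 :: real ^ 'n) 1) * s ^ CARD('n)"
    using le \<epsilon> \<nu> s(1) unfolding fin by (subst (asm) ennreal_le_iff) simp_all
  have "0 < ?e"
    using pos by (intro order_less_le_trans[OF _ ge]) simp
  moreover have "{x. \<rho> x \<le> s} \<subseteq> \<Omega>"
    using sublevel_subset s(2) by auto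
  ultimately show "{x. \<rho> x \<le> s} \<in> pos_compacts A g \<Omega>"
    using compact_sublevel[OF s(2)] by (simp add: pos_compacts_def)
qed

end

section \<open>Vanishing of the infima\<close>

lemma INF_eq_zero_of_tendsto:
  fixes \<Phi> :: "'c \<Rightarrow> ennreal" and h :: "'b \<Rightarrow> real"
  assumes F: "F \<noteq> bot" and bound: "\<forall>\<^sub>F s in F. K s \<in> S \<and> \<Phi> (K s) \<le> ennreal (h s)"
    and lim: "(h \<longlongrightarrow> 0) F"
  shows "(INF K\<in>S. \<Phi> K) = 0"
proof -
  have "(INF K\<in>S. \<Phi> K) \<le> 0 + ennreal e" if "0 < e" for e :: real
  proof -
    have "\<forall>\<^sub>F s in F. h s < e"
      using order_tendstoD(2)[OF lim that] .
    with bound have "\<forall>\<^sub>F s in F. K s \<in> S \<and> \<Phi> (K s) \<le> ennreal e"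
      by eventually_elim (meson ennreal_leI less_imp_le order_trans)
    then obtain s where "K s \<in> S" "\<Phi> (K s) \<le> ennreal e"
      using eventually_happens'[OF F] by blast
    then show ?thesis
      by (auto intro: INF_lower2)
  qed
  then have "(INF K\<in>S. \<Phi> K) \<le> 0"
    using ennreal_le_epsilon by blast
  then show ?thesis
    by simp
qed

text \<open>
  Bounding by the sum of the two endpoint values avoids a distinction by the sign of the exponent.
\<close>

lemma powr_between_le:
  fixes a x b e :: real
  assumes "0 < a" "a \<le> x" "x \<le> b"
  shows "x powr e \<le> a powr e + b powr e"
proof (cases "0 \<le> e")
  case True
  then have "x powr e \<le> b powr e"
    using assms by (intro powr_mono2) auto
  then show ?thesis
    by (simp add: add_increasing)
next
  case False
  then have "x powr e \<le> a powr e"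
    using assms by (intro powr_mono2') auto
  then show ?thesis
    by (simp add: add_increasing2)
qed

lemma exp_neg_capacity_le:
  assumes C: "C \<le> ennreal a" and a: "0 < a" and n: "1 < n" and \<beta>: "0 \<le> \<beta>"
  shows "exp_neg_capacity \<beta> n C \<le> exp (- \<beta> * a powr (1 / (1 - n)))"
proof (cases "C = 0")
  case True
  then show ?thesis
    by (simp add: exp_neg_capacity_def)
next
  case False
  have "C < top"
    using C by (rule order_le_less_trans) simp
  then have "0 < enn2real C"
    using False by (simp add: enn2real_positive_iff zero_less_iff_neq_zero)
  moreover have "enn2real C \<le> a"
    using C a by (simp add: enn2real_leI)
  ultimately have "a powr (1 / (1 - n)) \<le> enn2real C powr (1 / (1 - n))"
    using n by (intro powr_mono2') (auto simp: divide_nonneg_neg divide_le_0_iff)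
  then show ?thesis
    using False \<beta> by (simp add: exp_neg_capacity_def mult_left_mono)
qed

context almost_euclidean_ball
begin

text \<open>
  Single cutoffs on shrinking balls: the volume contributes \<open>s\<^bsup>- n \<alpha>\<^esup>\<close> and the capacity \<open>s\<^bsup>n - p\<^esup>\<close>. The
  volume is bounded from both sides because \<open>\<alpha>\<close> may have either sign.
\<close>

lemma INF_volume_powr_times_p_capacity:
  assumes \<epsilon>1: "\<epsilon> < 1" and p: "0 \<le> p" and \<alpha>: "\<alpha> < 1 - p / real CARD('n)"
  shows "(INF K\<in>pos_compacts A g \<Omega>.
    ennreal (measure (riem_volume A g) K powr (- \<alpha>)) * p_capacity A g p K \<Omega>) = 0"
proof -
  define n where "n = real CARD('n)"
  have n: "0 < n"
    by (simp add: n_def)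
  define \<nu> where "\<nu> = measure lborel (ball (0 :: real ^ 'n) 1)"
  define lo hi where "lo = (1 - \<epsilon>) * \<nu>" and "hi = (1 + \<epsilon>) * \<nu>"
  have \<nu>: "0 < \<nu>"
    by (simp add: \<nu>_def content_ball)
  have lohi: "0 < lo" "0 < hi"
    using \<epsilon> \<epsilon>1 \<nu> by (simp_all add: lo_def hi_def)
  define m where "m = 2 * (1 + \<epsilon>) * (1 + 1) / (real 1 * (1 - (1/2)\<^sup>2))"
  have m: "0 < m"
    using \<epsilon> by (simp add: m_def power2_eq_square)
  define e where "e = n - p - n * \<alpha>"
  have e: "0 < e"
    using \<alpha> n by (simp add: e_def n_def field_simps)
  define B where "B = (lo * (1/2) ^ CARD('n)) powr (- \<alpha>) + (hi * (1/2) ^ CARD('n)) powr (- \<alpha>)"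
  have bound: "{x. \<rho> x \<le> s / 2} \<in> pos_compacts A g \<Omega> \<and>
      ennreal (measure (riem_volume A g) {x. \<rho> x \<le> s / 2} powr (- \<alpha>))
        * p_capacity A g p {x. \<rho> x \<le> s / 2} \<Omega> \<le> ennreal (B * m powr p * hi * s powr e)"
    if s: "0 < s" "s \<le> R" for s
  proof -
    let ?K = "{x. \<rho> x \<le> s / 2}" and ?V = "measure (riem_volume A g) {x. \<rho> x \<le> s / 2}"
    have "s / 2 \<le> R" "0 < s / 2"
      using s R by auto
    note vol = sublevel_volume[OF this(2,1) \<epsilon>1]
    have "?V powr (- \<alpha>) \<le> (lo * (s / 2) ^ CARD('n)) powr (- \<alpha>) + (hi * (s / 2) ^ CARD('n)) powr (- \<alpha>)"
      using vol(2,3) lohi s by (intro powr_between_le) (auto simp: lo_def hi_def \<nu>_def)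
    also have "\<dots> = B * (s ^ CARD('n)) powr (- \<alpha>)"
      using lohi s by (simp add: B_def powr_mult power_divide power_one_over field_simps powr_divide)
    also have "(s ^ CARD('n)) powr (- \<alpha>) = s powr (- n * \<alpha>)"
      using s by (simp add: n_def powr_powr flip: powr_realpow)
    finally have V: "?V powr (- \<alpha>) \<le> B * s powr (- n * \<alpha>)" .
    have half: "0 < (1/2 :: real)" "(1/2 :: real) < 1" "0 < (1 :: real)" "0 < (1 :: nat)"
      by auto
    have "p_capacity A g p ?K \<Omega> \<le> ennreal ((m / s) powr p * (hi * (s ^ CARD('n) - (1/2 * s) ^ CARD('n))))"
      using p_capacity_le[OF half(1,2) s half(3,4) p, of ?K] by (simp add: m_def hi_def \<nu>_def)
    also have "\<dots> \<le> ennreal ((m / s) powr p * (hi * s ^ CARD('n)))"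
      using s lohi by (intro ennreal_leI mult_left_mono) auto
    also have "(m / s) powr p * (hi * s ^ CARD('n)) = m powr p * hi * s powr (n - p)"
      using s m by (simp add: n_def powr_divide powr_diff powr_realpow)
    finally have cap: "p_capacity A g p ?K \<Omega> \<le> ennreal (m powr p * hi * s powr (n - p))" .
    have "ennreal (?V powr (- \<alpha>)) * p_capacity A g p ?K \<Omega>
        \<le> ennreal (B * s powr (- n * \<alpha>)) * ennreal (m powr p * hi * s powr (n - p))"
      using V cap by (intro mult_mono ennreal_leI) auto
    also have "\<dots> = ennreal (B * m powr p * hi * (s powr (- n * \<alpha>) * s powr (n - p)))"
      using lohi by (subst ennreal_mult[symmetric]) (auto simp: B_def mult_ac)
    also have "s powr (- n * \<alpha>) * s powr (n - p) = s powr e"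
      by (simp add: e_def flip: powr_add)
    finally show ?thesis
      using vol(1) by simp
  qed
  have "\<forall>\<^sub>F s in at_right 0. 0 < s \<and> s \<le> R"
    using R by (intro eventually_at_rightI[of 0 R]) auto
  then have ev: "\<forall>\<^sub>F s in at_right 0. {x. \<rho> x \<le> s / 2} \<in> pos_compacts A g \<Omega> \<and>
      ennreal (measure (riem_volume A g) {x. \<rho> x \<le> s / 2} powr (- \<alpha>))
        * p_capacity A g p {x. \<rho> x \<le> s / 2} \<Omega> \<le> ennreal (B * m powr p * hi * s powr e)"
    by eventually_elim (rule bound; simp)
  have "((\<lambda>s. s powr e) \<longlongrightarrow> 0) (at_right 0)"
    using e by real_asymp
  then have "((\<lambda>s. B * m powr p * hi * s powr e) \<longlongrightarrow> 0) (at_right 0)"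
    by (rule tendsto_mult_right_zero)
  from INF_eq_zero_of_tendsto[OF _ ev this] show ?thesis
    by simp
qed

text \<open>
  The cutoff of the largest ball serves all smaller ones, so only the volume varies.
\<close>

lemma INF_volume_powr_times_infty_capacity:
  assumes \<epsilon>1: "\<epsilon> < 1"
  shows "(INF K\<in>pos_compacts A g \<Omega>.
    ennreal (measure (riem_volume A g) K powr (1 / real CARD('n))) * infty_capacity A g K \<Omega>) = 0"
proof -
  define hi where "hi = (1 + \<epsilon>) * measure lborel (ball (0 :: real ^ 'n) 1)"
  have hi: "0 < hi"
    using \<epsilon> by (simp add: hi_def content_ball)
  have bound: "{x. \<rho> x \<le> s} \<in> pos_compacts A g \<Omega> \<and>
      ennreal (measure (riem_volume A g) {x. \<rho> x \<le> s} powr (1 / real CARD('n)))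
        * infty_capacity A g {x. \<rho> x \<le> s} \<Omega>
      \<le> ennreal (hi powr (1 / real CARD('n)) * (6 * (1 + \<epsilon>) / R) * s)"
    if s: "0 < s" "s \<le> R / 2" for s
  proof -
    have "s \<le> R"
      using s R by simp
    note vol = sublevel_volume[OF s(1) this \<epsilon>1]
    have "measure (riem_volume A g) {x. \<rho> x \<le> s} powr (1 / real CARD('n))
        \<le> (hi * s ^ CARD('n)) powr (1 / real CARD('n))"
      using vol(3) by (intro powr_mono2) (auto simp: hi_def)
    also have "\<dots> = hi powr (1 / real CARD('n)) * s"
      using s hi by (simp add: powr_mult powr_powr flip: powr_realpow)
    finally have "ennreal (measure (riem_volume A g) {x. \<rho> x \<le> s} powr (1 / real CARD('n)))
        * infty_capacity A g {x. \<rho> x \<le> s} \<Omega>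
        \<le> ennreal (hi powr (1 / real CARD('n)) * s) * ennreal (6 * (1 + \<epsilon>) / R)"
      using s by (intro mult_mono ennreal_leI infty_capacity_le[OF R order_refl]) auto
    also have "\<dots> = ennreal (hi powr (1 / real CARD('n)) * (6 * (1 + \<epsilon>) / R) * s)"
      using s \<epsilon> R by (subst ennreal_mult[symmetric]) (auto simp: mult_ac)
    finally show ?thesis
      using vol(1) by simp
  qed
  have "\<forall>\<^sub>F s in at_right 0. 0 < s \<and> s \<le> R / 2"
    using R by (intro eventually_at_rightI[of 0 "R / 2"]) auto
  then have ev: "\<forall>\<^sub>F s in at_right 0. {x. \<rho> x \<le> s} \<in> pos_compacts A g \<Omega> \<and>
      ennreal (measure (riem_volume A g) {x. \<rho> x \<le> s} powr (1 / real CARD('n)))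
        * infty_capacity A g {x. \<rho> x \<le> s} \<Omega>
      \<le> ennreal (hi powr (1 / real CARD('n)) * (6 * (1 + \<epsilon>) / R) * s)"
    by eventually_elim (rule bound; simp)
  have "((\<lambda>s::real. s) \<longlongrightarrow> 0) (at_right 0)"
    by (rule tendsto_ident_at)
  then have "((\<lambda>s. hi powr (1 / real CARD('n)) * (6 * (1 + \<epsilon>) / R) * s) \<longlongrightarrow> 0) (at_right 0)"
    by (rule tendsto_mult_right_zero)
  from INF_eq_zero_of_tendsto[OF _ ev this] show ?thesis
    by simp
qed

text \<open>
  Each of the \<open>N\<close> layers has energy at most \<open>E / N\<^sup>n\<close>, independently of its scale, so the capacity is at most
  \<open>E N\<^bsup>1 - n\<^esup>\<close> and its power \<open>1 / (1 - n)\<close> grows linearly in \<open>N\<close>, as does the logarithm of the inverse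
  volume. The assumption \<open>decay\<close> says that the former rate wins.
\<close>

lemma INF_inverse_volume_times_exp_capacity:
  fixes b \<delta> \<beta> :: real
  defines "n \<equiv> real CARD('n)"
  defines "E \<equiv> (1 + \<epsilon>) * measure lborel (ball (0 :: real ^ 'n) 1) * (1 - b ^ CARD('n))
    * (2 * (1 + \<epsilon>) * (1 + \<delta>) / (1 - b\<^sup>2)) ^ CARD('n)"
  assumes \<epsilon>1: "\<epsilon> < 1" and b: "0 < b" "b < 1" and \<delta>: "0 < \<delta>" and n2: "2 \<le> n" and \<beta>: "0 \<le> \<beta>"
    and decay: "n * ln (1 / b) < \<beta> * E powr (1 / (1 - n))"
  shows "(INF K\<in>pos_compacts A g \<Omega>. ennreal (inverse (measure (riem_volume A g) K) *
    exp_neg_capacity \<beta> n (p_capacity A g n K \<Omega>))) = 0"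
proof -
  define \<nu> where "\<nu> = measure lborel (ball (0 :: real ^ 'n) 1)"
  have \<nu>: "0 < \<nu>"
    by (simp add: \<nu>_def content_ball)
  define q where "q = 2 * (1 + \<epsilon>) * (1 + \<delta>) / (1 - b\<^sup>2)"
  have q: "0 < q"
    using b \<epsilon> \<delta> by (simp add: q_def abs_square_less_1)
  have bn: "b ^ CARD('n) < 1"
    using b by (simp add: power_less_one_iff)
  have E_eq: "E = (1 + \<epsilon>) * \<nu> * (1 - b ^ CARD('n)) * q ^ CARD('n)"
    by (simp add: E_def q_def \<nu>_def)
  have E: "0 < E"
    using \<epsilon> \<nu> q bn by (simp add: E_eq)
  define \<kappa> where "\<kappa> = n * ln (1 / b) - \<beta> * E powr (1 / (1 - n))"
  have \<kappa>: "\<kappa> < 0"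
    using decay by (simp add: \<kappa>_def)
  define c where "c = inverse ((1 - \<epsilon>) * \<nu> * R ^ CARD('n))"
  have c: "0 \<le> c"
    using \<epsilon>1 \<nu> R by (simp add: c_def)
  have bound: "{x. \<rho> x \<le> b ^ N * R} \<in> pos_compacts A g \<Omega> \<and>
      ennreal (inverse (measure (riem_volume A g) {x. \<rho> x \<le> b ^ N * R})
        * exp_neg_capacity \<beta> n (p_capacity A g n {x. \<rho> x \<le> b ^ N * R} \<Omega>))
      \<le> ennreal (c * exp \<kappa> ^ N)" if N: "0 < N" for N
  proof -
    let ?K = "{x. \<rho> x \<le> b ^ N * R}"
    have s: "0 < b ^ N * R" "b ^ N * R \<le> R"
      using b R by (auto simp: mult_le_cancel_right2 power_le_one)
    note vol = sublevel_volume[OF s \<epsilon>1]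
    have term_eq: "(q / real N / (b ^ k * R)) powr n *
        ((1 + \<epsilon>) * \<nu> * ((b ^ k * R) ^ CARD('n) - (b * (b ^ k * R)) ^ CARD('n)))
        = E / real N ^ CARD('n)" for k
    proof -
      define D where "D = b ^ k * R"
      have D: "0 < D"
        using b R by (simp add: D_def)
      have powr_eq: "(q / real N / D) powr n = q ^ CARD('n) / real N ^ CARD('n) / D ^ CARD('n)"
        using q N D by (simp add: n_def powr_realpow power_divide power_mult_distrib)
      have shell_eq: "D ^ CARD('n) - (b * D) ^ CARD('n) = D ^ CARD('n) * (1 - b ^ CARD('n))"
        by (simp add: power_mult_distrib algebra_simps)
      show ?thesis
        unfolding D_def[symmetric] powr_eq shell_eq E_eq using D by simp
    qed
    have m_eq: "2 * (1 + \<epsilon>) * (1 + \<delta>) / (real N * (1 - b\<^sup>2)) = q / real N"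
      by (simp add: q_def)
    have "p_capacity A g n ?K \<Omega> \<le> ennreal (\<Sum>k<N. E / real N ^ CARD('n))"
      using p_capacity_le[OF b R order_refl \<delta> N, of n ?K] n2
      unfolding \<nu>_def[symmetric] m_eq term_eq by simp
    also have "(\<Sum>k<N. E / real N ^ CARD('n)) = E * real N powr (1 - n)"
      using N by (simp add: n_def powr_diff powr_realpow)
    finally have cap: "p_capacity A g n ?K \<Omega> \<le> ennreal (E * real N powr (1 - n))" .
    have "exp_neg_capacity \<beta> n (p_capacity A g n ?K \<Omega>)
        \<le> exp (- \<beta> * (E * real N powr (1 - n)) powr (1 / (1 - n)))"
      using cap E N n2 \<beta> by (intro exp_neg_capacity_le) auto
    also have "(E * real N powr (1 - n)) powr (1 / (1 - n)) = E powr (1 / (1 - n)) * real N"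
      using E N n2 by (simp add: powr_mult powr_powr)
    finally have exp_le: "exp_neg_capacity \<beta> n (p_capacity A g n ?K \<Omega>)
        \<le> exp (- \<beta> * (E powr (1 / (1 - n)) * real N))" .
    have pos: "0 < (1 - \<epsilon>) * \<nu> * (b ^ N * R) ^ CARD('n)"
      using \<epsilon>1 \<nu> s by simp
    have "inverse (measure (riem_volume A g) ?K) \<le> inverse ((1 - \<epsilon>) * \<nu> * (b ^ N * R) ^ CARD('n))"
      using vol(2) pos by (intro le_imp_inverse_le) (auto simp: \<nu>_def)
    also have "\<dots> = c * inverse (b ^ N) ^ CARD('n)"
      by (simp add: c_def power_mult_distrib power_inverse)
    also have "inverse (b ^ N) ^ CARD('n) = exp (n * ln (1 / b) * real N)"
    proof -
      have "inverse (b ^ N) ^ CARD('n) = (1 / b) ^ (N * CARD('n))"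
        by (simp add: power_mult power_inverse inverse_eq_divide power_one_over)
      also have "\<dots> = exp (ln (1 / b)) ^ (N * CARD('n))"
        using b by simp
      also have "\<dots> = exp (n * ln (1 / b) * real N)"
        by (simp add: n_def mult_ac flip: exp_of_nat_mult)
      finally show ?thesis .
    qed
    finally have "inverse (measure (riem_volume A g) ?K) \<le> c * exp (n * ln (1 / b) * real N)" .
    then have "inverse (measure (riem_volume A g) ?K) * exp_neg_capacity \<beta> n (p_capacity A g n ?K \<Omega>)
        \<le> c * exp (n * ln (1 / b) * real N) * exp (- \<beta> * (E powr (1 / (1 - n)) * real N))"
      using exp_le c by (intro mult_mono) (simp_all add: exp_neg_capacity_def)
    also have "\<dots> = c * exp \<kappa> ^ N"
      by (simp add: \<kappa>_def algebra_simps flip: exp_add exp_of_nat_mult)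
    finally show ?thesis
      using vol(1) by (simp add: ennreal_leI)
  qed
  have ev: "\<forall>\<^sub>F N in sequentially. {x. \<rho> x \<le> b ^ N * R} \<in> pos_compacts A g \<Omega> \<and>
      ennreal (inverse (measure (riem_volume A g) {x. \<rho> x \<le> b ^ N * R})
        * exp_neg_capacity \<beta> n (p_capacity A g n {x. \<rho> x \<le> b ^ N * R} \<Omega>))
      \<le> ennreal (c * exp \<kappa> ^ N)"
    using eventually_gt_at_top[of 0] by eventually_elim (rule bound)
  have "(\<lambda>N. exp \<kappa> ^ N) \<longlonglongrightarrow> 0"
    using \<kappa> by (intro LIMSEQ_power_zero) simp
  then have "(\<lambda>N. c * exp \<kappa> ^ N) \<longlonglongrightarrow> 0"
    by (rule tendsto_mult_right_zero)
  from INF_eq_zero_of_tendsto[OF sequentially_bot ev this] show ?thesis .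
qed

end

text \<open>
  With \<open>b = 1 - h\<close> the energy \<open>E\<close> behaves like \<open>v n h\<^bsup>1 - n\<^esup>\<close>: the factor \<open>1 - b\<^sup>n\<close> is of order \<open>n h\<close> and
  \<open>1 - b\<^sup>2\<close> of order \<open>2 h\<close>. The powers of \<open>h\<close> cancel against \<open>ln (1 / b)\<close>, which is of order \<open>h\<close>. In \<open>X\<close>
  these powers are divided out.
\<close>

lemma sharp_constant_limit:
  fixes d :: nat and v :: real
  assumes d: "2 \<le> d" and v: "0 < v"
  shows "((\<lambda>h. real d * ln (1 / (1 - h)) * ((1 + h) * v * (1 - (1 - h) ^ d)
      * (2 * (1 + h) * (1 + h) / (1 - (1 - h)\<^sup>2)) ^ d) powr (1 / (real d - 1)))
    \<longlongrightarrow> real d powr (real d / (real d - 1)) * v powr (1 / (real d - 1))) (at_right 0)"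
proof -
  define X where "X h = (1 + h) * v * (\<Sum>i<d. (1 - h) ^ i) * (2 * (1 + h) * (1 + h) / (2 - h)) ^ d" for h
  have "((\<lambda>h. real d * (ln (1 / (1 - h)) / h) * X h powr (1 / (real d - 1)))
      \<longlongrightarrow> real d * 1 * ((1 + 0) * v * (\<Sum>i<d. (1 - 0) ^ i) * (2 * (1 + 0) * (1 + 0) / (2 - 0)) ^ d)
        powr (1 / (real d - 1))) (at_right 0)"
  proof (intro tendsto_mult tendsto_const tendsto_powr)
    show "((\<lambda>h::real. ln (1 / (1 - h)) / h) \<longlongrightarrow> 1) (at_right 0)"
      by real_asymp
    show "(X \<longlongrightarrow> (1 + 0) * v * (\<Sum>i<d. (1 - 0) ^ i) * (2 * (1 + 0) * (1 + 0) / (2 - 0)) ^ d) (at_right 0)"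
      unfolding X_def by (intro tendsto_intros) auto
  qed (use v d in auto)
  also have "real d * 1 * ((1 + 0) * v * (\<Sum>i<d. (1 - 0) ^ i) * (2 * (1 + 0) * (1 + 0) / (2 - 0)) ^ d)
      powr (1 / (real d - 1)) = real d powr (real d / (real d - 1)) * v powr (1 / (real d - 1))"
  proof -
    have "real d powr (1 + 1 / (real d - 1)) = real d * real d powr (1 / (real d - 1))"
      using d by (simp add: powr_add)
    moreover have "1 + 1 / (real d - 1) = real d / (real d - 1)"
      using d by (simp add: field_simps)
    ultimately show ?thesis
      using v by (simp add: powr_mult)
  qed
  finally have lim: "((\<lambda>h. real d * (ln (1 / (1 - h)) / h) * X h powr (1 / (real d - 1)))
      \<longlongrightarrow> real d powr (real d / (real d - 1)) * v powr (1 / (real d - 1))) (at_right 0)" .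
  show ?thesis
  proof (rule Lim_transform_eventually[OF lim])
    have "\<forall>\<^sub>F h in at_right 0. 0 < h \<and> h < (1::real)"
      by (intro eventually_at_rightI[of 0 1]) auto
    then show "\<forall>\<^sub>F h in at_right 0. real d * (ln (1 / (1 - h)) / h) * X h powr (1 / (real d - 1))
      = real d * ln (1 / (1 - h)) * ((1 + h) * v * (1 - (1 - h) ^ d)
        * (2 * (1 + h) * (1 + h) / (1 - (1 - h)\<^sup>2)) ^ d) powr (1 / (real d - 1))"
    proof eventually_elim
      case (elim h)
      have geo: "1 - (1 - h) ^ d = h * (\<Sum>i<d. (1 - h) ^ i)"
        using one_diff_power_eq[of "1 - h" d] by simp
      have sq: "1 - (1 - h)\<^sup>2 = h * (2 - h)"
        by (simp add: power2_eq_square algebra_simps)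
      have X: "0 < X h"
        using elim v d unfolding X_def
        by (intro mult_pos_pos sum_pos zero_less_power divide_pos_pos) (auto simp: lessThan_empty_iff)
      have "(1 + h) * v * (1 - (1 - h) ^ d) * (2 * (1 + h) * (1 + h) / (1 - (1 - h)\<^sup>2)) ^ d
          = X h * (h / h ^ d)"
        unfolding geo sq X_def by (simp add: power_divide power_mult_distrib mult_ac)
      also have "h / h ^ d = h powr (1 - real d)"
        using elim by (simp add: powr_diff powr_realpow)
      finally have "((1 + h) * v * (1 - (1 - h) ^ d)
          * (2 * (1 + h) * (1 + h) / (1 - (1 - h)\<^sup>2)) ^ d) powr (1 / (real d - 1))
          = X h powr (1 / (real d - 1)) * h powr ((1 - real d) * (1 / (real d - 1)))"
        using X elim by (simp add: powr_mult powr_powr)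
      also have "(1 - real d) * (1 / (real d - 1)) = - 1"
        using d by (simp add: field_simps)
      also have "h powr - 1 = 1 / h"
        using elim by (simp add: powr_minus_divide)
      finally show ?case
        by simp
    qed
  qed
qed

theorem theorem1p1:
  fixes A :: "('a::{second_countable_topology, t2_space}, 'n::finite) chart set"
    and g :: "('a, 'n) metric_coeffs"
    and \<Omega> :: "'a set"
  defines "n \<equiv> real CARD('n)"
  assumes "riemannian_manifold A g"
    and "riem_complete A g"
    and "open \<Omega>" and "connected \<Omega>" and "\<Omega> \<noteq> {}"
    and "riem_bounded A g \<Omega>"
  shows "(\<forall>p \<alpha>. 1 \<le> p \<and> p \<noteq> n \<and> \<alpha> < 1 - p / n \<longrightarrow>
            (INF K\<in>pos_compacts A g \<Omega>.
               ennreal (measure (riem_volume A g) K powr (- \<alpha>)) * p_capacity A g p K \<Omega>) = 0) \<and>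
         (INF K\<in>pos_compacts A g \<Omega>.
            ennreal (measure (riem_volume A g) K powr (1 / n)) * infty_capacity A g K \<Omega>) = 0 \<and>
         (2 \<le> n \<longrightarrow>
           (\<forall>\<beta>. n powr (n / (n - 1)) * measure lborel (ball (0 :: real ^ 'n) 1) powr (1 / (n - 1)) < \<beta> \<longrightarrow>
             (INF K\<in>pos_compacts A g \<Omega>.
                ennreal (inverse (measure (riem_volume A g) K) *
                  exp_neg_capacity \<beta> n (p_capacity A g n K \<Omega>))) = 0))"
proof -
  note ball_exists = almost_euclidean_ball_exists[OF assms(2,4,6)]
  obtain R \<rho> where ball: "almost_euclidean_ball A g \<Omega> (1/2) R \<rho>"
    using ball_exists[of "1/2"] by auto
  have sub: "(INF K\<in>pos_compacts A g \<Omega>.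
      ennreal (measure (riem_volume A g) K powr (- \<alpha>)) * p_capacity A g p K \<Omega>) = 0"
    if "1 \<le> p" "\<alpha> < 1 - p / n" for p \<alpha>
    by (rule almost_euclidean_ball.INF_volume_powr_times_p_capacity[OF ball])
       (use that in \<open>auto simp: n_def\<close>)
  have inf: "(INF K\<in>pos_compacts A g \<Omega>.
      ennreal (measure (riem_volume A g) K powr (1 / n)) * infty_capacity A g K \<Omega>) = 0"
    unfolding n_def by (rule almost_euclidean_ball.INF_volume_powr_times_infty_capacity[OF ball]) simp
  have crit: "(INF K\<in>pos_compacts A g \<Omega>. ennreal (inverse (measure (riem_volume A g) K) *
      exp_neg_capacity \<beta> n (p_capacity A g n K \<Omega>))) = 0"
    if n2: "2 \<le> n"
      and \<beta>: "n powr (n / (n - 1)) * measure lborel (ball (0 :: real ^ 'n) 1) powr (1 / (n - 1)) < \<beta>" for \<beta>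
  proof -
    define v where "v = measure lborel (ball (0 :: real ^ 'n) 1)"
    have v: "0 < v"
      by (simp add: v_def content_ball)
    define E where "E h = (1 + h) * v * (1 - (1 - h) ^ CARD('n))
      * (2 * (1 + h) * (1 + h) / (1 - (1 - h)\<^sup>2)) ^ CARD('n)" for h
    have "2 \<le> CARD('n)"
      using n2 by (simp add: n_def)
    from order_tendstoD(2)[OF sharp_constant_limit[OF this v] \<beta>[unfolded n_def, folded v_def]]
    have "\<forall>\<^sub>F h in at_right 0. n * ln (1 / (1 - h)) * E h powr (1 / (n - 1)) < \<beta>"
      by (simp add: n_def E_def)
    moreover have "\<forall>\<^sub>F h in at_right 0. 0 < h \<and> h < (1::real)"
      by (intro eventually_at_rightI[of 0 1]) auto
    ultimately have "\<forall>\<^sub>F h in at_right 0. n * ln (1 / (1 - h)) * E h powr (1 / (n - 1)) < \<beta> \<and>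
        0 < h \<and> h < 1"
      by eventually_elim simp
    then obtain h where h: "n * ln (1 / (1 - h)) * E h powr (1 / (n - 1)) < \<beta>" "0 < h" "h < 1"
      using eventually_happens'[OF trivial_limit_at_right_real] by blast
    obtain R' \<rho>' where ball': "almost_euclidean_ball A g \<Omega> h R' \<rho>'"
      using ball_exists[OF h(2)] by auto
    have "(1 - h)\<^sup>2 < 1" "(1 - h) ^ CARD('n) < 1"
      using h by (auto simp: abs_square_less_1 power_less_one_iff)
    then have E: "0 < E h"
      using h v by (simp add: E_def)
    have "0 \<le> \<beta>"
      using \<beta> by (rule order_trans[OF _ less_imp_le, rotated]) simp
    have "1 / (1 - n) = - (1 / (n - 1))"
      using n2 by (simp add: field_simps)
    then have inv: "E h powr (1 / (1 - n)) * E h powr (1 / (n - 1)) = 1"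
      using E by (simp flip: powr_add)
    have "n * ln (1 / (1 - h)) * E h powr (1 / (n - 1)) * E h powr (1 / (1 - n)) < \<beta> * E h powr (1 / (1 - n))"
      using h(1) E by (intro mult_strict_right_mono) auto
    then have decay: "n * ln (1 / (1 - h)) < \<beta> * E h powr (1 / (1 - n))"
      using inv by (simp add: mult.assoc mult.commute[of "E h powr (1 / (n - 1))"])
    show ?thesis
      unfolding n_def
      by (rule almost_euclidean_ball.INF_inverse_volume_times_exp_capacity[OF ball', of "1 - h" h])
         (use h n2 \<open>0 \<le> \<beta>\<close> decay in \<open>auto simp: n_def E_def v_def\<close>)
  qed
  show ?thesis
    using sub inf crit by blast
qed

end
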